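(* Let $(M,\varphi)$ be a $7$-manifold with coclosed $G_2$-structure. Then every coRochesterian vector field on $M$ is a co$G_2$-vector field, i.e. $\mathcal{X}_{coRoc}(M)\subseteq\mathcal{X}_{coG_2}(M)$. Moreover, if every closed $3$-form lying in $\Omega^3_7(M)$ is exact, then $\mathcal{X}_{coRoc}(M)=\mathcal{X}_{coG_2}(M)$.
   Context: On $\mathbb{R}^7$ let $\varphi_0=dx^{123}+dx^{145}+dx^{167}+dx^{246}-dx^{257}-dx^{347}-dx^{356}$, where $dx^{ijk}=dx^i\wedge dx^j\wedge dx^k$. A $G_2$-structure on a smooth $7$-manifold $M$ is a smooth $3$-form $\varphi$ such that for each $p\in M$ there is a linear isomorphism $T_pM\cong\mathbb{R}^7$ carrying $\varphi_p$ to $\varphi_0$. It determines a Riemannian metric $\langle\cdot,\cdot\rangle_\varphi$ and an orientation by $(X\lrcorner\varphi)\wedge(Y\lrcorner\varphi)\wedge\varphi=6\langle X,Y\rangle_\varphi\, d\mathrm{vol}_\varphi$; $\star$ is the associated Hodge star. The structure is coclosed if $d^*\varphi=0$, equivalently $d(\star\varphi)=0$. $\mathcal{X}(M)$ is the space of smooth vector fields and $\Omega^3_7(M)=\{X\lrcorner\star\varphi: X\in\mathcal{X}(M)\}$, where $X\lrcorner\omega=\omega(X,\cdot,\dots)$. The map $X\mapsto X\lrcorner\star\varphi$ is injective. Let $(M,\varphi)$ have a coclosed $G_2$-structure. A coRochesterian $2$-form is a $2$-form $\sigma$ with $d\sigma\in\Omega^3_7(M)$; its coRochesterian vector field is the unique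 vector field $X_\sigma$ with $X_\sigma\lrcorner\star\varphi=d\sigma$. $\mathcal{X}_{coRoc}(M)$ is the set of all such vector fields $X_\sigma$. A co$G_2$-vector field is a vector field $X$ with $\mathcal{L}_X(\star\varphi)=0$; the set of these is $\mathcal{X}_{coG_2}(M)$. *)

theory Defs
  imports "HOL-Analysis.Analysis"
begin

section \<open>Smooth maps on open subsets of Euclidean space\<close>

text \<open>
  For open \<open>S\<close> in a finite-dimensional space, \<open>f\<close> is of class \<open>C\<^sup>k\<^sup>+\<^sup>1\<close> iff it is differentiable
  and every directional derivative is of class \<open>C\<^sup>k\<close>.  Both predicates are only used on open sets.
\<close>

fun Ck_on :: "nat \<Rightarrow> ('v::euclidean_space \<Rightarrow> 'w::real_normed_vector) \<Rightarrow> 'v set \<Rightarrow> bool" where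
  "Ck_on 0 f S \<longleftrightarrow> continuous_on S f"
| "Ck_on (Suc k) f S \<longleftrightarrow>
     f differentiable_on S \<and> (\<forall>v. Ck_on k (\<lambda>x. frechet_derivative f (at x) v) S)"

definition smooth_on :: "('v::euclidean_space \<Rightarrow> 'w::real_normed_vector) \<Rightarrow> 'v set \<Rightarrow> bool" where
  "smooth_on f S \<longleftrightarrow> (\<forall>k. Ck_on k f S)"


section \<open>Exterior algebra\<close>

text \<open>
  A \<open>k\<close>-covector is an alternating \<open>k\<close>-linear function of lists of \<open>k\<close> vectors, extended by \<open>0\<close> to
  lists of any other length.
\<close>

definition covector :: "nat \<Rightarrow> ('v::real_vector list \<Rightarrow> real) \<Rightarrow> bool" where
  "covector k \<alpha> \<longleftrightarrow>
     (\<forall>vs. length vs \<noteq> k \<longrightarrow> \<alpha> vs = 0) \<and>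
     (\<forall>vs i. length vs = k \<longrightarrow> i < k \<longrightarrow> linear (\<lambda>v. \<alpha> (vs[i := v]))) \<and>
     (\<forall>vs i j. length vs = k \<longrightarrow> i < j \<longrightarrow> j < k \<longrightarrow> vs ! i = vs ! j \<longrightarrow> \<alpha> vs = 0)"

text \<open>
  The normalisation of the wedge product is the one in which
  \<open>dx\<^sup>1 \<and> \<dots> \<and> dx\<^sup>n\<close> takes the value \<open>1\<close> on the standard basis.
\<close>

definition wedge :: "nat \<Rightarrow> nat \<Rightarrow> ('v list \<Rightarrow> real) \<Rightarrow> ('v list \<Rightarrow> real) \<Rightarrow> 'v list \<Rightarrow> real" where
  "wedge p q \<alpha> \<beta> = (\<lambda>vs. if length vs = p + q
     then (\<Sum>\<pi> | \<pi> permutes {..<p + q}.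
             of_int (sign \<pi>) * \<alpha> (map (\<lambda>i. vs ! \<pi> i) [0..<p]) * \<beta> (map (\<lambda>i. vs ! \<pi> i) [p..<p + q]))
          / (fact p * fact q)
     else 0)"

definition contract :: "'v \<Rightarrow> ('v list \<Rightarrow> real) \<Rightarrow> 'v list \<Rightarrow> real" where
  "contract v \<alpha> = (\<lambda>vs. \<alpha> (v # vs))"

definition dx :: "'n::finite \<Rightarrow> (real^'n) list \<Rightarrow> real" where
  "dx i = (\<lambda>vs. if length vs = 1 then (vs ! 0) $ i else 0)"

definition dx3 :: "'n::finite \<Rightarrow> 'n \<Rightarrow> 'n \<Rightarrow> (real^'n) list \<Rightarrow> real" where
  "dx3 i j k = wedge 2 1 (wedge 1 1 (dx i) (dx j)) (dx k)"

text \<open>The index type \<open>7\<close> has the seven distinct elements \<open>1, \<dots>, 7\<close> (with \<open>7 = 0\<close>).\<close>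

definition phi0 :: "(real^7) list \<Rightarrow> real" where
  "phi0 = (\<lambda>vs. dx3 1 2 3 vs + dx3 1 4 5 vs + dx3 1 6 7 vs + dx3 2 4 6 vs
                - dx3 2 5 7 vs - dx3 3 4 7 vs - dx3 3 5 6 vs)"

definition is_inner_product :: "('v::real_vector \<Rightarrow> 'v \<Rightarrow> real) \<Rightarrow> bool" where
  "is_inner_product g \<longleftrightarrow>
     bilinear g \<and> (\<forall>u v. g u v = g v u) \<and> (\<forall>v. v \<noteq> 0 \<longrightarrow> g v v > 0)"

text \<open>
  The two volume forms of an inner product are the top-degree covectors of absolute value \<open>1\<close> on
  orthonormal bases; choosing one of them is choosing an orientation.
\<close>

definition is_volume_form :: "(real^'n::finite \<Rightarrow> real^'n \<Rightarrow> real) \<Rightarrow> ((real^'n) list \<Rightarrow> real) \<Rightarrow> bool" where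
  "is_volume_form g \<mu> \<longleftrightarrow> covector CARD('n) \<mu> \<and>
     (\<forall>es. length es = CARD('n) \<longrightarrow>
        (\<forall>i<CARD('n). \<forall>j<CARD('n). g (es ! i) (es ! j) = (if i = j then 1 else 0)) \<longrightarrow>
        \<bar>\<mu> es\<bar> = 1)"

text \<open>
  The Hodge star of a \<open>k\<close>-covector with respect to an inner product \<open>g\<close> and a volume form \<open>\<mu>\<close> of
  \<open>g\<close>, by the index formula
  \<open>(\<star>\<beta>)\<^bsub>a\<^sub>1\<dots>\<^esub> = 1/k! g\<^bsup>i\<^sub>1j\<^sub>1\<^esup> \<dots> g\<^bsup>i\<^sub>kj\<^sub>k\<^esup> \<beta>\<^bsub>j\<^sub>1\<dots>j\<^sub>k\<^esub> \<mu>\<^bsub>i\<^sub>1\<dots>i\<^sub>ka\<^sub>1\<dots>\<^esub>\<close>,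
  so that \<open>\<alpha> \<and> \<star>\<beta> = \<langle>\<alpha>,\<beta>\<rangle> \<mu>\<close>.
\<close>

definition inverse_gram :: "(real^'n::finite \<Rightarrow> real^'n \<Rightarrow> real) \<Rightarrow> real^'n^'n" where
  "inverse_gram g = matrix_inv (\<chi> i j. g (axis i 1) (axis j 1))"

definition hodge_star ::
  "(real^'n::finite \<Rightarrow> real^'n \<Rightarrow> real) \<Rightarrow> ((real^'n) list \<Rightarrow> real) \<Rightarrow> nat
     \<Rightarrow> ((real^'n) list \<Rightarrow> real) \<Rightarrow> (real^'n) list \<Rightarrow> real" where
  "hodge_star g \<mu> k \<beta> = (\<lambda>vs. if k + length vs = CARD('n)
     then (\<Sum>is | length is = k. \<Sum>js | length js = k.
             (\<Prod>m<k. inverse_gram g $ (is ! m) $ (js ! m))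
             * \<beta> (map (\<lambda>j. axis j 1) js) * \<mu> (map (\<lambda>i. axis i 1) is @ vs)) / fact k
     else 0)"

text \<open>
  The inner product and volume form that a covector in the orbit of \<open>phi0\<close> determines.  The value is
  arbitrary outside that orbit.
\<close>

definition g2_metric_vol ::
  "((real^7) list \<Rightarrow> real) \<Rightarrow> (real^7 \<Rightarrow> real^7 \<Rightarrow> real) \<times> ((real^7) list \<Rightarrow> real)" where
  "g2_metric_vol \<phi> = (THE (g, \<mu>). is_inner_product g \<and> is_volume_form g \<mu> \<and>
     (\<forall>X Y vs. wedge 4 3 (wedge 2 2 (contract X \<phi>) (contract Y \<phi>)) \<phi> vs = 6 * g X Y * \<mu> vs))"

definition g2_star3 :: "((real^7) list \<Rightarrow> real) \<Rightarrow> (real^7) list \<Rightarrow> real" where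
  "g2_star3 \<phi> = hodge_star (fst (g2_metric_vol \<phi>)) (snd (g2_metric_vol \<phi>)) 3 \<phi>"


section \<open>Smooth manifolds\<close>

type_synonym ('a, 'n) chart = "'a set \<times> ('a \<Rightarrow> real^'n)"

abbreviation chart_dom :: "('a, 'n::finite) chart \<Rightarrow> 'a set" where
  "chart_dom c \<equiv> fst c"

abbreviation chart_map :: "('a, 'n::finite) chart \<Rightarrow> 'a \<Rightarrow> real^'n" where
  "chart_map c \<equiv> snd c"

abbreviation chart_img :: "('a, 'n::finite) chart \<Rightarrow> (real^'n) set" where
  "chart_img c \<equiv> chart_map c ` chart_dom c"

definition chart_inv :: "('a, 'n::finite) chart \<Rightarrow> real^'n \<Rightarrow> 'a" where
  "chart_inv c = inv_into (chart_dom c) (chart_map c)"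

definition transition :: "('a, 'n::finite) chart \<Rightarrow> ('a, 'n) chart \<Rightarrow> real^'n \<Rightarrow> real^'n" where
  "transition c d = chart_map d \<circ> chart_inv c"

text \<open>A smooth \<open>n\<close>-manifold, where \<open>n = CARD('n)\<close>; the atlas need not be maximal.\<close>

definition smooth_manifold :: "'a topology \<Rightarrow> ('a, 'n::finite) chart set \<Rightarrow> bool" where
  "smooth_manifold M A \<longleftrightarrow>
     Hausdorff_space M \<and> second_countable M \<and>
     (\<Union>c\<in>A. chart_dom c) = topspace M \<and>
     (\<forall>c\<in>A. openin M (chart_dom c) \<and> open (chart_img c) \<and>
        homeomorphic_map (subtopology M (chart_dom c)) (top_of_set (chart_img c)) (chart_map c)) \<and>
     (\<forall>c\<in>A. \<forall>d\<in>A. smooth_on (transition c d) (chart_map c ` (chart_dom c \<inter> chart_dom d)))"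

definition charts_at :: "('a, 'n::finite) chart set \<Rightarrow> 'a \<Rightarrow> ('a, 'n) chart set" where
  "charts_at A p = {c \<in> A. p \<in> chart_dom c}"

definition jac :: "('a, 'n::finite) chart \<Rightarrow> ('a, 'n) chart \<Rightarrow> 'a \<Rightarrow> real^'n \<Rightarrow> real^'n" where
  "jac c d p = frechet_derivative (transition c d) (at (chart_map c p))"


section \<open>Tangent vectors, vector fields and differential forms\<close>

text \<open>
  A tangent vector at \<open>p\<close> is the family \<open>v\<close> of its coordinate vectors \<open>v c\<close> in all charts \<open>c\<close> at
  \<open>p\<close>, related by the transformation law; the vector space operations are the pointwise ones.
\<close>

definition tangent_space :: "('a, 'n::finite) chart set \<Rightarrow> 'a \<Rightarrow> (('a, 'n) chart \<Rightarrow> real^'n) set" where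
  "tangent_space A p = {v.
     (\<forall>c\<in>charts_at A p. \<forall>d\<in>charts_at A p. v d = jac c d p (v c)) \<and>
     (\<forall>c. c \<notin> charts_at A p \<longrightarrow> v c = 0)}"

definition tangent_iso ::
  "('a, 'n::finite) chart set \<Rightarrow> 'a \<Rightarrow> ((('a, 'n) chart \<Rightarrow> real^'n) \<Rightarrow> real^'n) \<Rightarrow> bool" where
  "tangent_iso A p L \<longleftrightarrow> bij_betw L (tangent_space A p) UNIV \<and>
     (\<forall>u\<in>tangent_space A p. \<forall>v\<in>tangent_space A p. \<forall>a b.
        L (\<lambda>c. a *\<^sub>R u c + b *\<^sub>R v c) = a *\<^sub>R L u + b *\<^sub>R L v)"

definition vector_fields ::
  "('a, 'n::finite) chart set \<Rightarrow> ('a \<Rightarrow> ('a, 'n) chart \<Rightarrow> real^'n) set" where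
  "vector_fields A = {X.
     (\<forall>p. X p \<in> tangent_space A p) \<and>
     (\<forall>c\<in>A. smooth_on (\<lambda>x. X (chart_inv c x) c) (chart_img c))}"

text \<open>
  Likewise, a \<open>k\<close>-form \<open>\<omega>\<close> assigns to \<open>p\<close> and each chart \<open>c\<close> at \<open>p\<close> the expression
  \<open>\<omega> p c\<close> of \<open>\<omega>\<^sub>p\<close> in the coordinates \<open>c\<close>: the value of \<open>\<omega>\<^sub>p\<close> on tangent vectors
  \<open>v\<^sub>1, \<dots>, v\<^sub>k\<close> is \<open>\<omega> p c [v\<^sub>1 c, \<dots>, v\<^sub>k c]\<close>, for any such \<open>c\<close>.
\<close>

type_synonym ('a, 'n) dform = "'a \<Rightarrow> ('a, 'n) chart \<Rightarrow> (real^'n) list \<Rightarrow> real"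

definition dforms :: "('a, 'n::finite) chart set \<Rightarrow> nat \<Rightarrow> ('a, 'n) dform set" where
  "dforms A k = {\<omega>.
     (\<forall>p. \<forall>c\<in>charts_at A p. covector k (\<omega> p c)) \<and>
     (\<forall>p. \<forall>c\<in>charts_at A p. \<forall>d\<in>charts_at A p. \<forall>vs. \<omega> p c vs = \<omega> p d (map (jac c d p) vs)) \<and>
     (\<forall>p c. c \<notin> charts_at A p \<longrightarrow> \<omega> p c = (\<lambda>vs. 0)) \<and>
     (\<forall>c\<in>A. \<forall>vs. smooth_on (\<lambda>x. \<omega> (chart_inv c x) c vs) (chart_img c))}"

definition zero_form :: "('a, 'n::finite) dform" where
  "zero_form = (\<lambda>p c vs. 0)"

definition interior :: "('a \<Rightarrow> ('a, 'n::finite) chart \<Rightarrow> real^'n) \<Rightarrow> ('a, 'n) dform \<Rightarrow> ('a, 'n) dform" where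
  "interior X \<omega> = (\<lambda>p c. contract (X p c) (\<omega> p c))"

text \<open>
  In a chart,
  \<open>d\<omega>(v\<^sub>0, \<dots>, v\<^sub>k) = \<Sum>\<^sub>i (-1)\<^sup>i D\<^bsub>v\<^sub>i\<^esub> (\<omega>(v\<^sub>0, \<dots>, v\<^sub>i omitted, \<dots>, v\<^sub>k))\<close>
  for constant vectors \<open>v\<^sub>0, \<dots>, v\<^sub>k\<close>.
\<close>

definition ext_d :: "('a, 'n::finite) chart set \<Rightarrow> ('a, 'n) dform \<Rightarrow> ('a, 'n) dform" where
  "ext_d A \<omega> = (\<lambda>p c vs. if c \<in> charts_at A p
     then (\<Sum>i<length vs. (-1) ^ i *
             frechet_derivative (\<lambda>x. \<omega> (chart_inv c x) c (take i vs @ drop (Suc i) vs))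
               (at (chart_map c p)) (vs ! i))
     else 0)"

text \<open>
  In a chart,
  \<open>(L\<^sub>X \<omega>)(v\<^sub>1, \<dots>, v\<^sub>k) = D\<^sub>X (\<omega>(v\<^sub>1, \<dots>, v\<^sub>k)) + \<Sum>\<^sub>i \<omega>(v\<^sub>1, \<dots>, D\<^bsub>v\<^sub>i\<^esub>X, \<dots>, v\<^sub>k)\<close>
  for constant vectors \<open>v\<^sub>1, \<dots>, v\<^sub>k\<close>; this is
  \<open>(L\<^sub>X \<omega>)(Y\<^sub>1, \<dots>) = X(\<omega>(Y\<^sub>1, \<dots>)) - \<Sum>\<^sub>i \<omega>(\<dots>, [X, Y\<^sub>i], \<dots>)\<close>
  on constant coordinate fields, where \<open>[X, v] = - D\<^sub>v X\<close>.
\<close>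

definition lie_deriv ::
  "('a, 'n::finite) chart set \<Rightarrow> ('a \<Rightarrow> ('a, 'n) chart \<Rightarrow> real^'n) \<Rightarrow> ('a, 'n) dform \<Rightarrow> ('a, 'n) dform" where
  "lie_deriv A X \<omega> = (\<lambda>p c vs. if c \<in> charts_at A p
     then frechet_derivative (\<lambda>x. \<omega> (chart_inv c x) c vs) (at (chart_map c p)) (X p c)
        + (\<Sum>i<length vs. \<omega> p c
             (vs[i := frechet_derivative (\<lambda>x. X (chart_inv c x) c) (at (chart_map c p)) (vs ! i)]))
     else 0)"


section \<open>Coclosed \<open>G\<^sub>2\<close>-structures\<close>

definition g2_structure :: "('a, 7) chart set \<Rightarrow> ('a, 7) dform \<Rightarrow> bool" where
  "g2_structure A \<phi> \<longleftrightarrow> \<phi> \<in> dforms A 3 \<and>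
     (\<forall>p\<in>(\<Union>c\<in>A. chart_dom c). \<exists>L. tangent_iso A p L \<and>
        (\<forall>u\<in>tangent_space A p. \<forall>v\<in>tangent_space A p. \<forall>w\<in>tangent_space A p. \<forall>c\<in>charts_at A p.
           \<phi> p c [u c, v c, w c] = phi0 [L u, L v, L w]))"

definition star_phi :: "('a, 7) dform \<Rightarrow> ('a, 7) dform" where
  "star_phi \<phi> = (\<lambda>p c. g2_star3 (\<phi> p c))"

definition coclosed :: "('a, 7) chart set \<Rightarrow> ('a, 7) dform \<Rightarrow> bool" where
  "coclosed A \<phi> \<longleftrightarrow> ext_d A (star_phi \<phi>) = zero_form"

definition Omega37 :: "('a, 7) chart set \<Rightarrow> ('a, 7) dform \<Rightarrow> ('a, 7) dform set" where
  "Omega37 A \<phi> = {interior X (star_phi \<phi>) | X. X \<in> vector_fields A}"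

definition coRoc_forms :: "('a, 7) chart set \<Rightarrow> ('a, 7) dform \<Rightarrow> ('a, 7) dform set" where
  "coRoc_forms A \<phi> = {\<sigma> \<in> dforms A 2. ext_d A \<sigma> \<in> Omega37 A \<phi>}"

definition coRoc_fields ::
  "('a, 7) chart set \<Rightarrow> ('a, 7) dform \<Rightarrow> ('a \<Rightarrow> ('a, 7) chart \<Rightarrow> real^7) set" where
  "coRoc_fields A \<phi> =
     {X \<in> vector_fields A. \<exists>\<sigma>\<in>coRoc_forms A \<phi>. interior X (star_phi \<phi>) = ext_d A \<sigma>}"

definition coG2_fields ::
  "('a, 7) chart set \<Rightarrow> ('a, 7) dform \<Rightarrow> ('a \<Rightarrow> ('a, 7) chart \<Rightarrow> real^7) set" where
  "coG2_fields A \<phi> = {X \<in> vector_fields A. lie_deriv A X (star_phi \<phi>) = zero_form}"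

end

(* Cartan's formula and d(star phi) = 0 give L_X (star phi) = d (X _| star phi), so that both claims
   follow from d d = 0.  The work lies in the regularity of star phi, which Cartan's formula needs:
   star phi must be shown to be a field of alternating forms, differentiable in every chart.
   Pointwise phi is the pullback of phi0 under a linear isomorphism, which exhibits the metric and
   the volume form.  The bilinear form B(X, Y) = (X _| phi) /\ (Y _| phi) /\ phi / 6, evaluated on
   a fixed basis e, is polynomial in phi and equals g(X, Y) mu(e); since det g = mu(e)^2, this gives
   det B = mu(e)^9, so that mu(e), g and star phi depend differentiably on phi. *)
theory Submission
  imports Defs
begin

text \<open>The isomorphism with the model is only given point by point, so nothing built from it
  can be differentiated directly; each quantity must first be rewritten in terms of \<phi>. The
  exponent is 9 = 7 + 2: each of the seven rows of the matrix of B contributes mu(e), and det g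
  contributes mu(e)^2. Being odd, it gives a root that is differentiable away from 0 whatever the
  sign of mu(e), so no orientation has to be chosen. The same exponent yields uniqueness of the pair
  (g, mu), without which the definite description in \<open>g2_metric_vol\<close> would say nothing.
  Existence rests on one contraction of \<open>phi0\<close> with the Levi-Civita symbol, equal to
  144 times the Kronecker delta. It is checked by evaluation over the integers; the lemmas on
  sorting, determinants and iterated wedges bring the permutation sums of \<open>wedge\<close> into
  that form. Cartan's formula differentiates star phi once, while d d = 0 is applied to the 2-form
  \<sigma>, smooth by definition; this is why star phi is studied at the level of first
  derivatives.\<close>

section \<open>Covectors and wedge products\<close>

lemma covector_length: "covector k \<alpha> \<Longrightarrow> length vs \<noteq> k \<Longrightarrow> \<alpha> vs = 0"
  by (simp add: covector_def)

lemma covector_linear: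
  "covector k \<alpha> \<Longrightarrow> length vs = k \<Longrightarrow> i < k \<Longrightarrow> linear (\<lambda>v. \<alpha> (vs[i := v]))"
  by (simp add: covector_def)

lemma covector_linear_middle:
  assumes "covector k \<alpha>" "Suc (length xs + length ys) = k"
  shows "linear (\<lambda>v. \<alpha> (xs @ v # ys))"
  using covector_linear[OF assms(1), of "xs @ undefined # ys" "length xs"] assms(2)
  by simp

lemma covector_linear_Cons:
  "covector k \<alpha> \<Longrightarrow> Suc (length ys) = k \<Longrightarrow> linear (\<lambda>v. \<alpha> (v # ys))"
  using covector_linear_middle[of k \<alpha> "[]" ys] by simp

lemma covector_repeated:
  assumes "covector k \<alpha>" "\<not> distinct vs"
  shows "\<alpha> vs = 0"
proof (cases "length vs = k")
  case True
  obtain i j where "i < length vs" "j < length vs" "i \<noteq> j" "vs ! i = vs ! j"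
    using assms(2) by (auto simp: distinct_conv_nth)
  moreover have "\<alpha> vs = 0" if "i < j" "j < length vs" "vs ! i = vs ! j" for i j
    using assms(1) True that unfolding covector_def by blast
  ultimately show ?thesis by (metis linorder_neqE_nat)
qed (use assms(1) covector_length in blast)

section \<open>Signs of reordered arguments\<close>

lemma covector_swap_adjacent:
  assumes "covector k \<alpha>"
  shows "\<alpha> (xs @ a # b # ys) = - \<alpha> (xs @ b # a # ys)"
proof (cases "Suc (Suc (length xs + length ys)) = k")
  case True
  have l1: "linear (\<lambda>v. \<alpha> (xs @ v # c # ys))" for c
    using covector_linear_middle[OF assms, of xs "c # ys"] True by simp
  have l2: "linear (\<lambda>v. \<alpha> (xs @ c # v # ys))" for c
    using covector_linear_middle[OF assms, of "xs @ [c]" ys] True by simp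
  have r: "\<alpha> (xs @ c # c # ys) = 0" for c
    by (rule covector_repeated[OF assms]) simp
  show ?thesis
    using r[of "a + b"] r[of a] r[of b]
    by (simp add: linear_add[OF l1] linear_add[OF l2])
next
  case False
  then show ?thesis using assms by (simp add: covector_length)
qed

lemma covector_move:
  assumes "covector k \<alpha>"
  shows "\<alpha> (xs @ a # ys @ zs) = (-1) ^ length ys * \<alpha> (xs @ ys @ a # zs)"
proof (induction ys arbitrary: xs)
  case (Cons y ys)
  have "\<alpha> (xs @ a # y # ys @ zs) = - \<alpha> ((xs @ [y]) @ a # ys @ zs)"
    using covector_swap_adjacent[OF assms, of xs a y "ys @ zs"] by simp
  then show ?case using Cons.IH[of "xs @ [y]"] by simp
qed simp

text \<open>The new vector travels past the i entries before its slot. In Cartan's formula this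
  absorbs the sign (-1)^i of the i-th term of d and leaves the unsigned terms of the Lie
  derivative.\<close>

lemma covector_move_update:
  assumes "covector k \<alpha>" "i < length vs"
  shows "\<alpha> (a # take i vs @ drop (Suc i) vs) = (-1) ^ i * \<alpha> (vs[i := a])"
  using covector_move[OF assms(1), of "[]" a "take i vs" "drop (Suc i) vs"] assms(2)
  by (simp add: upd_conv_take_nth_drop)

text \<open>The sign of a list of indices as an index of the Levi-Civita symbol.\<close>

fun inv_sign :: "nat list \<Rightarrow> int" where
  "inv_sign [] = 1"
| "inv_sign (x # xs) =
     (if x \<in> set xs then 0 else (-1) ^ length (filter (\<lambda>y. y < x) xs) * inv_sign xs)"

lemma inv_sign_eq_0: "\<not> distinct xs \<Longrightarrow> inv_sign xs = 0"
  by (induction xs) auto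

text \<open>\<open>insort\<close> carries \<open>x\<close> past exactly the smaller entries of
  \<open>ys\<close>, one adjacent swap each.\<close>

lemma covector_insort:
  assumes "covector k \<alpha>" "sorted ys" "x \<notin> set ys"
  shows "\<alpha> (xs @ h x # map h ys) =
    (-1) ^ length (filter (\<lambda>y. y < x) ys) * \<alpha> (xs @ map h (insort x ys))"
  using assms(2,3)
proof (induction ys arbitrary: xs)
  case (Cons y ys)
  show ?case
  proof (cases "x \<le> y")
    case True
    then have "filter (\<lambda>z. z < x) (y # ys) = []" using Cons.prems by (auto simp: filter_empty_conv)
    then show ?thesis using True by (simp del: filter.simps)
  next
    case False
    have "\<alpha> (xs @ h x # h y # map h ys) = - \<alpha> ((xs @ [h y]) @ h x # map h ys)"
      using covector_swap_adjacent[OF assms(1), of xs "h x" "h y" "map h ys"] by simp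
    then show ?thesis using Cons.IH[of "xs @ [h y]"] Cons.prems False by simp
  qed
qed simp

text \<open>Insertion sort, with the swaps of each insertion counted by \<open>inv_sign\<close>; a
  repeated index makes both sides 0.\<close>

lemma covector_sort:
  assumes "covector k \<alpha>"
  shows "\<alpha> (xs @ map h is) = of_int (inv_sign is) * \<alpha> (xs @ map h (sort is))"
proof (induction "is" arbitrary: xs)
  case (Cons x js)
  show ?case
  proof (cases "x \<in> set js")
    case True
    have "\<alpha> (xs @ map h (x # js)) = 0"
      by (rule covector_repeated[OF assms]) (use True in auto)
    then show ?thesis using True by simp
  next
    case False
    have f: "length (filter (\<lambda>y. y < x) (sort js)) = length (filter (\<lambda>y. y < x) js)"
      by (metis mset_filter mset_sort size_mset)
    have "\<alpha> (xs @ map h (x # js)) = of_int (inv_sign js) * \<alpha> (xs @ h x # map h (sort js))"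
      using Cons.IH[of "xs @ [h x]"] by simp
    also have "\<dots> = of_int (inv_sign (x # js)) * \<alpha> (xs @ map h (sort (x # js)))"
      using covector_insort[OF assms, of "sort js" x xs h] f False by simp
    finally show ?thesis .
  qed
qed simp

text \<open>A permutation \<tau> of the first p + q positions is absorbed by \<pi>: composing with
  it only permutes the outer summands. So every \<tau> yields the same outer sum, and their number
  (p + q)! cancels the factorial in the outer normalisation.\<close>

lemma wedge_wedge:
  assumes "length vs = p + q + r"
  shows "wedge (p + q) r (wedge p q \<alpha> \<beta>) \<gamma> vs =
    (\<Sum>\<pi> | \<pi> permutes {..<p + q + r}. of_int (sign \<pi>) *
        \<alpha> (map (\<lambda>i. vs ! \<pi> i) [0..<p]) * \<beta> (map (\<lambda>i. vs ! \<pi> i) [p..<p + q]) *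
        \<gamma> (map (\<lambda>i. vs ! \<pi> i) [p + q..<p + q + r])) / (fact p * fact q * fact r)"
proof -
  define n where "n = p + q + r"
  define F where "F \<pi> = of_int (sign \<pi>) *
        \<alpha> (map (\<lambda>i. vs ! \<pi> i) [0..<p]) * \<beta> (map (\<lambda>i. vs ! \<pi> i) [p..<p + q]) *
        \<gamma> (map (\<lambda>i. vs ! \<pi> i) [p + q..<n])" for \<pi>
  have inner: "wedge p q \<alpha> \<beta> (map (\<lambda>i. vs ! \<pi> i) [0..<p + q]) * of_int (sign \<pi>) *
      \<gamma> (map (\<lambda>i. vs ! \<pi> i) [p + q..<n])
      = (\<Sum>\<tau> | \<tau> permutes {..<p + q}. F (\<pi> \<circ> \<tau>)) / (fact p * fact q)"
    if \<pi>: "\<pi> permutes {..<n}" for \<pi>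
  proof -
    have "of_int (sign \<tau>) * \<alpha> (map (\<lambda>i. map (\<lambda>i. vs ! \<pi> i) [0..<p + q] ! \<tau> i) [0..<p]) *
        \<beta> (map (\<lambda>i. map (\<lambda>i. vs ! \<pi> i) [0..<p + q] ! \<tau> i) [p..<p + q]) * of_int (sign \<pi>) *
        \<gamma> (map (\<lambda>i. vs ! \<pi> i) [p + q..<n]) = F (\<pi> \<circ> \<tau>)"
      if \<tau>: "\<tau> permutes {..<p + q}" for \<tau>
    proof -
      have lt: "\<tau> i < p + q" if "i < p + q" for i
        using permutes_in_image[OF \<tau>, of i] that by simp
      have fx: "\<tau> i = i" if "p + q \<le> i" for i
        using permutes_not_in[OF \<tau>] that by simp
      have s: "sign (\<pi> \<circ> \<tau>) = sign \<pi> * sign \<tau>"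
        using \<pi> \<tau> by (intro sign_compose) (auto simp: permutation_permutes)
      have e1: "map (\<lambda>i. map (\<lambda>i. vs ! \<pi> i) [0..<p + q] ! \<tau> i) [0..<p]
          = map (\<lambda>i. vs ! (\<pi> \<circ> \<tau>) i) [0..<p]"
        using lt by (auto simp: nth_append)
      have e2: "map (\<lambda>i. map (\<lambda>i. vs ! \<pi> i) [0..<p + q] ! \<tau> i) [p..<p + q]
          = map (\<lambda>i. vs ! (\<pi> \<circ> \<tau>) i) [p..<p + q]"
        using lt by (auto simp: nth_append)
      have e3: "map (\<lambda>i. vs ! \<pi> i) [p + q..<n] = map (\<lambda>i. vs ! (\<pi> \<circ> \<tau>) i) [p + q..<n]"
        using fx by auto
      show ?thesis unfolding F_def s e1 e2 e3 by (simp only: of_int_mult mult_ac)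
    qed
    then show ?thesis
      unfolding wedge_def
      by (simp add: sum_divide_distrib sum_distrib_right sum_distrib_left del: map_eq_conv)
  qed
  have "wedge (p + q) r (wedge p q \<alpha> \<beta>) \<gamma> vs =
      (\<Sum>\<pi> | \<pi> permutes {..<n}. wedge p q \<alpha> \<beta> (map (\<lambda>i. vs ! \<pi> i) [0..<p + q]) *
        of_int (sign \<pi>) * \<gamma> (map (\<lambda>i. vs ! \<pi> i) [p + q..<n])) / (fact (p + q) * fact r)"
    using assms unfolding wedge_def[of "p + q" r] n_def by (simp add: mult.commute)
  also have "\<dots> = (\<Sum>\<pi> | \<pi> permutes {..<n}. \<Sum>\<tau> | \<tau> permutes {..<p + q}. F (\<pi> \<circ> \<tau>))
      / (fact p * fact q) / (fact (p + q) * fact r)"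
    by (simp add: inner sum_divide_distrib)
  also have "(\<Sum>\<pi> | \<pi> permutes {..<n}. \<Sum>\<tau> | \<tau> permutes {..<p + q}. F (\<pi> \<circ> \<tau>))
      = (\<Sum>\<tau> | \<tau> permutes {..<p + q}. \<Sum>\<pi> | \<pi> permutes {..<n}. F \<pi>)"
  proof (subst sum.swap, rule sum.cong[OF refl])
    fix \<tau> assume "\<tau> \<in> {\<tau>. \<tau> permutes {..<p + q}}"
    then have "\<tau> permutes {..<n}" by (auto intro: permutes_subset simp: n_def)
    then show "(\<Sum>\<pi> | \<pi> permutes {..<n}. F (\<pi> \<circ> \<tau>)) = (\<Sum>\<pi> | \<pi> permutes {..<n}. F \<pi>)"
      by (rule sum_permutations_compose_right[symmetric])
  qed
  also have "\<dots> = fact (p + q) * (\<Sum>\<pi> | \<pi> permutes {..<n}. F \<pi>)"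
    using card_permutations[of "{..<p + q}" "p + q"] by (simp add: of_nat_fact)
  finally show ?thesis by (simp add: F_def n_def)
qed

text \<open>\<open>det\<close> wants rows indexed by a finite type, forms take lists;
  \<open>e\<close> is the numbering that matches the two.\<close>

definition det_form :: "('n::finite \<Rightarrow> nat) \<Rightarrow> (real^'n) list \<Rightarrow> real" where
  "det_form e vs = (if length vs = CARD('n) then det (\<chi> r. vs ! e r) else 0)"

lemma covector_det_form:
  fixes e :: "'n::finite \<Rightarrow> nat"
  assumes e: "bij_betw e UNIV {..<CARD('n)}"
  shows "covector CARD('n) (det_form e)"
  unfolding covector_def
proof (intro conjI allI impI)
  fix vs :: "(real^'n) list" and i
  assume vs: "length vs = CARD('n)" and i: "i < CARD('n)"
  obtain k where k: "e k = i" using e i by (metis bij_betw_imp_surj_on imageE lessThan_iff)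
  have inj: "i = e r \<longleftrightarrow> r = k" for r
    using e k by (metis bij_betw_imp_inj_on injD)
  have lt: "e r < CARD('n)" for r using e by (auto simp: bij_betw_def)
  have "det_form e (vs[i := v]) = det (\<chi> r. if r = k then v else vs ! e r)" for v
  proof -
    have "(\<chi> r. vs[i := v] ! e r) = (\<chi> r. if r = k then v else vs ! e r)"
      by (simp add: vec_eq_iff nth_list_update vs lt inj k i)
    then show ?thesis using vs by (simp add: det_form_def)
  qed
  then show "linear (\<lambda>v. det_form e (vs[i := v]))"
    by (intro linearI)
      (simp_all add: det_row_add det_row_mul flip: scalar_mult_eq_scaleR)
next
  fix vs :: "(real^'n) list" and i j
  assume vs: "length vs = CARD('n)" and ij: "i < j" "j < CARD('n)" "vs ! i = vs ! j"
  obtain k l where kl: "e k = i" "e l = j" 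
    using e ij by (metis bij_betw_imp_surj_on imageE lessThan_iff less_trans)
  show "det_form e vs = 0"
    unfolding det_form_def using kl ij
    by (auto intro!: det_identical_rows[of k l] simp: row_def)
qed (simp add: det_form_def)

text \<open>The Leibniz formula, with permutations of list positions in place of permutations of the
  index type. The r-th argument on the right collects the \<open>c r\<close>-th coordinates of all
  the vectors, so that a repetition or reordering of the indices \<open>c\<close> becomes one of
  arguments.\<close>

lemma det_form_columns:
  fixes e :: "'n::finite \<Rightarrow> nat" and c :: "nat \<Rightarrow> 'n"
  assumes e: "bij_betw e UNIV {..<CARD('n)}"
  shows "(\<Sum>\<pi> | \<pi> permutes {..<CARD('n)}. of_int (sign \<pi>) * (\<Prod>r<CARD('n). vs ! \<pi> r $ c r))
    = det_form e (map (\<lambda>r. \<chi> b. vs ! e b $ c r) [0..<CARD('n)])"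
proof -
  let ?n = "CARD('n)"
  define f where "f = inv e"
  have inj: "inj e" using e by (rule bij_betw_imp_inj_on)
  have f: "bij_betw f {..<?n} UNIV" unfolding f_def using e by (rule bij_betw_inv_into)
  have fe: "f (e a) = a" for a by (simp add: f_def inj)
  have ef: "e (f i) = i" if "i < ?n" for i
    using e that by (simp add: f_def bij_betw_inv_into_right)
  have en: "e a < ?n" for a using e by (auto simp: bij_betw_def)
  \<comment> \<open>Conjugation by the numbering, which preserves the sign; outside the list
    positions a permutation of \<open>{..<?n}\<close> has to be the identity.\<close>
  define T where "T \<pi> = (\<lambda>i. if i \<in> {..<?n} then e (\<pi> (f i)) else i)" for \<pi> :: "'n \<Rightarrow> 'n"
  have perm: "T \<pi> permutes {..<?n}" "sign (T \<pi>) = sign \<pi>" if "\<pi> permutes UNIV" for \<pi>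
  proof -
    interpret permutes_bij_finite \<pi> UNIV "{..<?n}" e f "T \<pi>"
      by unfold_locales (use that e fe in \<open>auto simp: T_def[abs_def]\<close>)
    show "T \<pi> permutes {..<?n}" "sign (T \<pi>) = sign \<pi>" by (rule permutes_p' sign_p')+
  qed
  have "bij_betw T {\<pi>. \<pi> permutes UNIV} {\<pi>. \<pi> permutes {..<?n}}"
  proof (rule bij_betwI[where g = "\<lambda>\<pi> a. f (\<pi> (e a))"])
    show "T \<in> {\<pi>. \<pi> permutes UNIV} \<rightarrow> {\<pi>. \<pi> permutes {..<?n}}" using perm by auto
    show "(\<lambda>\<pi> a. f (\<pi> (e a))) \<in> {\<pi>. \<pi> permutes {..<?n}} \<rightarrow> {\<pi>. \<pi> permutes UNIV}"
    proof clarsimp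
      fix \<pi> assume "\<pi> permutes {..<?n}"
      then have "bij_betw (f \<circ> \<pi> \<circ> e) UNIV UNIV"
        by (meson e f bij_betw_trans permutes_imp_bij)
      then show "(\<lambda>a. f (\<pi> (e a))) permutes UNIV"
        by (intro bij_imp_permutes) (simp_all add: o_def)
    qed
    show "(\<lambda>a. f (T \<pi> (e a))) = \<pi>" if "\<pi> \<in> {\<pi>. \<pi> permutes UNIV}" for \<pi>
      by (simp add: T_def en fe)
    show "T (\<lambda>a. f (\<pi> (e a))) = \<pi>" if "\<pi> \<in> {\<pi>. \<pi> permutes {..<?n}}" for \<pi>
    proof
      fix i
      have "\<pi> i < ?n" if "i < ?n" using permutes_in_image[of \<pi> "{..<?n}" i] \<open>\<pi> \<in> _\<close> that by simp
      moreover have "\<pi> i = i" if "\<not> i < ?n"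
        using permutes_not_in[of \<pi> "{..<?n}" i] \<open>\<pi> \<in> _\<close> that by simp
      ultimately show "T (\<lambda>a. f (\<pi> (e a))) i = \<pi> i" by (simp add: T_def ef)
    qed
  qed
  then have "(\<Sum>\<pi> | \<pi> permutes {..<?n}. of_int (sign \<pi>) * (\<Prod>r<?n. vs ! \<pi> r $ c r))
      = (\<Sum>\<pi> | \<pi> permutes (UNIV :: 'n set). of_int (sign (T \<pi>)) * (\<Prod>r<?n. vs ! T \<pi> r $ c r))"
    by (rule sum.reindex_bij_betw[symmetric])
  also have "\<dots> = (\<Sum>\<pi> | \<pi> permutes (UNIV :: 'n set).
      of_int (sign \<pi>) * (\<Prod>a\<in>UNIV. vs ! e (\<pi> a) $ c (e a)))"
  proof (rule sum.cong[OF refl])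
    fix \<pi> :: "'n \<Rightarrow> 'n" assume "\<pi> \<in> {\<pi>. \<pi> permutes UNIV}"
    moreover have "(\<Prod>r<?n. vs ! T \<pi> r $ c r) = (\<Prod>a\<in>UNIV. vs ! T \<pi> (e a) $ c (e a))"
      by (rule prod.reindex_bij_betw[OF e, symmetric])
    ultimately show "of_int (sign (T \<pi>)) * (\<Prod>r<?n. vs ! T \<pi> r $ c r) =
        of_int (sign \<pi>) * (\<Prod>a\<in>UNIV. vs ! e (\<pi> a) $ c (e a))"
      using perm by (simp add: T_def en fe)
  qed
  also have "\<dots> = det_form e (map (\<lambda>r. \<chi> b. vs ! e b $ c r) [0..<?n])"
    by (simp add: det_form_def det_def en)
  finally show ?thesis .
qed

section \<open>The cubic identity for \<open>phi0\<close>\<close>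

lemma dx3_expand:
  "dx3 i j k [u, v, w] =
     u$i * v$j * w$k - u$i * v$k * w$j + u$j * v$k * w$i - u$j * v$i * w$k
       + u$k * v$i * w$j - u$k * v$j * w$i"
proof -
  have "dx3 i j k [u, v, w] = (\<Sum>\<pi> | \<pi> permutes {0, 1, 2::nat}. of_int (sign \<pi>) *
     [u, v, w] ! \<pi> 0 $ i * [u, v, w] ! \<pi> 1 $ j * [u, v, w] ! \<pi> 2 $ k)"
    using wedge_wedge[of "[u, v, w]" 1 1 1 "dx i" "dx j" "dx k"]
    by (simp add: dx3_def dx_def numeral_2_eq_2 lessThan_Suc insert_commute)
  then show ?thesis
    by (simp add: sum_over_permutations_insert sign_compose sign_swap_id permutation_swap_id
        permutation_compose transpose_def)
qed

text \<open>
  The entries \<open>(j, k, s)\<close> for \<open>a\<close> list the terms \<open>s dx\<^sup>a\<^sup>j\<^sup>k\<close> of \<open>phi0\<close> that involve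
  \<open>a\<close>, with \<open>a\<close> moved to the front; \<open>a = 0\<close> is a dummy.
\<close>

definition phi0_table :: "nat \<Rightarrow> (nat \<times> nat \<times> int) list" where
  "phi0_table a = [[], [(2,3,1),(4,5,1),(6,7,1)], [(3,1,1),(4,6,1),(5,7,-1)],
     [(1,2,1),(4,7,-1),(5,6,-1)], [(5,1,1),(6,2,1),(7,3,-1)], [(1,4,1),(7,2,-1),(6,3,-1)],
     [(7,1,1),(2,4,1),(3,5,-1)], [(1,6,1),(2,5,-1),(3,4,-1)]] ! a"

text \<open>Both orders of each pair are listed, so that sums run over all nonzero components of
  \<open>phi0\<close> with first index \<open>a\<close>.\<close>

definition phi0_terms :: "nat \<Rightarrow> (nat \<times> nat \<times> int) list" where
  "phi0_terms a = concat (map (\<lambda>(j,k,s). [(j,k,s),(k,j,-s)]) (phi0_table a))"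

lemma phi0_expand:
  "phi0 [u, v, w] = (\<Sum>a\<leftarrow>[1..<8]. \<Sum>(j,k,s)\<leftarrow>phi0_terms a.
     of_int s * u $ of_nat a * v $ of_nat j * w $ of_nat k)"
proof -
  have u: "[1..<8] = [1,2,3,4,5,6,7::nat]" by code_simp
  have t: "phi0_terms 1 = [(2,3,1),(3,2,-1),(4,5,1),(5,4,-1),(6,7,1),(7,6,-1)]"
    "phi0_terms 2 = [(3,1,1),(1,3,-1),(4,6,1),(6,4,-1),(5,7,-1),(7,5,1)]"
    "phi0_terms 3 = [(1,2,1),(2,1,-1),(4,7,-1),(7,4,1),(5,6,-1),(6,5,1)]"
    "phi0_terms 4 = [(5,1,1),(1,5,-1),(6,2,1),(2,6,-1),(7,3,-1),(3,7,1)]"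
    "phi0_terms 5 = [(1,4,1),(4,1,-1),(7,2,-1),(2,7,1),(6,3,-1),(3,6,1)]"
    "phi0_terms 6 = [(7,1,1),(1,7,-1),(2,4,1),(4,2,-1),(3,5,-1),(5,3,1)]"
    "phi0_terms 7 = [(1,6,1),(6,1,-1),(2,5,-1),(5,2,1),(3,4,-1),(4,3,1)]"
    by code_simp+
  show ?thesis
    unfolding u phi0_def dx3_expand by (simp add: t del: One_nat_def)
qed

lemma phi0_length: "length vs \<noteq> 3 \<Longrightarrow> phi0 vs = 0"
  by (simp add: phi0_def dx3_def wedge_def)

text \<open>List positions start at \<open>0\<close>, but the coordinates of \<open>phi0\<close> are numbered \<open>1, \<dots>, 7 = 0\<close>.\<close>

definition ix7 :: "7 \<Rightarrow> nat" where
  "ix7 = inv_into {..<7} (\<lambda>i. of_nat (Suc i))"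

lemma bij_of_nat_Suc: "bij_betw (\<lambda>i. of_nat (Suc i) :: 7) {..<7} UNIV"
proof -
  have "inj_on (\<lambda>i. of_nat (Suc i) :: 7) {..<7}"
    by (simp add: lessThan_nat_numeral lessThan_Suc inj_on_def)
  moreover from this have "(\<lambda>i. of_nat (Suc i) :: 7) ` {..<7} = UNIV"
    by (intro card_subset_eq) (simp_all add: card_image)
  ultimately show ?thesis by (simp add: bij_betw_def)
qed

lemma bij_ix7: "bij_betw ix7 UNIV {..<7}"
  unfolding ix7_def using bij_of_nat_Suc by (rule bij_betw_inv_into)

lemma of_nat_Suc_ix7: "of_nat (Suc (ix7 r)) = r"
  unfolding ix7_def using bij_of_nat_Suc by (rule bij_betw_inv_into_right) simp

lemma ix7_of_nat_Suc: "i < 7 \<Longrightarrow> ix7 (of_nat (Suc i)) = i"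
  unfolding ix7_def using bij_betw_inv_into_left[OF bij_of_nat_Suc, of i] by (simp del: of_nat_Suc)

lemma ix7_less: "ix7 r < 7"
  using bij_ix7 by (auto simp: bij_betw_def)

definition vol7 :: "(real^7) list \<Rightarrow> real" where
  "vol7 = det_form ix7"

lemma covector_vol7: "covector 7 vol7"
  using covector_det_form[of ix7] bij_ix7 by (simp add: vol7_def)

text \<open>Sorting the indices costs the sign \<open>inv_sign is\<close>. Distinct indices sort to
  1, ..., 7 by counting, and the sorted columns form the transpose of the matrix of
  \<open>vs\<close>; with a repetition both sides vanish.\<close>

lemma vol7_columns:
  assumes "length is = 7" "set is \<subseteq> {1..7}" "length vs = 7"
  shows "vol7 (map (\<lambda>k. \<chi> b. vs ! ix7 b $ of_nat k) is) = of_int (inv_sign is) * vol7 vs"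
proof (cases "distinct is")
  case True
  have "vol7 (map (\<lambda>k. \<chi> b. vs ! ix7 b $ of_nat k) is)
      = of_int (inv_sign is) * vol7 (map (\<lambda>k. \<chi> b. vs ! ix7 b $ of_nat k) (sort is))"
    using covector_sort[OF covector_vol7, of "[]" _ "is"] by simp
  also have "sort is = [1..<8]"
  proof (rule sorted_distinct_set_unique)
    have "card (set is) = card {1..7::nat}" using True assms(1) by (simp add: distinct_card)
    with assms(2) have "set is = {1..7}" by (intro card_subset_eq) simp_all
    moreover have "set [1..<8] = {1..7::nat}" by auto
    ultimately show "set (sort is) = set [1..<8]" by (simp only: set_sort)
  qed (use True in simp_all)
  also have "vol7 (map (\<lambda>k. \<chi> b. vs ! ix7 b $ of_nat k) [1..<8]) = vol7 vs"
  proof -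
    have "(\<chi> r. map (\<lambda>k. \<chi> b. vs ! ix7 b $ of_nat k) [1..<8] ! ix7 r)
        = transpose (\<chi> r. vs ! ix7 r)"
      using of_nat_Suc_ix7 ix7_less by (simp add: vec_eq_iff transpose_def)
    then show ?thesis using assms(3) by (simp add: vol7_def det_form_def)
  qed
  finally show ?thesis .
next
  case False
  then have "\<not> distinct (map (\<lambda>k. \<chi> b. vs ! ix7 b $ of_nat k :: real^7) is)"
    using distinct_map by blast
  then have "vol7 (map (\<lambda>k. \<chi> b. vs ! ix7 b $ of_nat k) is) = 0"
    by (rule covector_repeated[OF covector_vol7])
  then show ?thesis using False by (simp add: inv_sign_eq_0)
qed

text \<open>
  The triple contraction \<open>\<phi>\<^bsub>ajk\<^esub> \<phi>\<^bsub>blm\<^esub> \<phi>\<^bsub>cpq\<^esub> \<epsilon>\<^bsub>jklmcpq\<^esub> = 144 \<delta>\<^bsub>ab\<^esub>\<close>, with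
  the terms that vanish for lack of distinctness pruned so that it can be evaluated.
\<close>

lemma phi0_terms_cubic:
  "list_all (\<lambda>a. list_all (\<lambda>b.
     (\<Sum>(j,k,s)\<leftarrow>phi0_terms a. \<Sum>(l,m,t)\<leftarrow>phi0_terms b. if distinct [j,k,l,m]
        then \<Sum>c\<leftarrow>[1..<8]. if c \<in> {j,k,l,m} then 0
          else \<Sum>(p,q,r)\<leftarrow>phi0_terms c. s * t * r * inv_sign [j,k,l,m,c,p,q]
        else 0)
     = (if a = b then 144 else 0)) [1..<8]) [1..<8]"
  by code_simp

lemma phi0_terms_range:
  assumes "a \<in> set [1..<8]" "t \<in> set (phi0_terms a)"
  shows "fst t \<in> {1..7}" "fst (snd t) \<in> {1..7}"
proof -
  have "list_all (\<lambda>a. list_all (\<lambda>t. 1 \<le> fst t \<and> fst t \<le> 7 \<and>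
    1 \<le> fst (snd t) \<and> fst (snd t) \<le> 7) (phi0_terms a)) [1..<8]"
    by code_simp
  then show "fst t \<in> {1..7}" "fst (snd t) \<in> {1..7}"
    using assms unfolding list_all_iff atLeastAtMost_iff by blast+
qed

lemma sum_sum_list_swap:
  fixes f :: "'a \<Rightarrow> 'b \<Rightarrow> 'c::comm_monoid_add"
  shows "(\<Sum>x\<in>A. \<Sum>y\<leftarrow>ys. f x y) = (\<Sum>y\<leftarrow>ys. \<Sum>x\<in>A. f x y)"
  by (induction ys) (simp_all add: sum.distrib)

text \<open>The shape of the cubic expression once its factors are expanded: only the third factor
  has its leading index summed, so the list \<open>ws z\<close> of its terms varies with that
  index.\<close>

lemma sum_list_product:
  fixes r :: "'r::semiring_0"
  shows "r * (sum_list (map f xs) * sum_list (map g ys) * (\<Sum>z\<leftarrow>zs. h z * sum_list (map (k z) (ws z))))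
    = (\<Sum>x\<leftarrow>xs. \<Sum>y\<leftarrow>ys. \<Sum>z\<leftarrow>zs. \<Sum>w\<leftarrow>ws z. r * (f x * g y * (h z * k z w)))"
  by (simp only: mult.assoc sum_list_const_mult sum_list_mult_const)

lemma of_int_sum_list: "of_int (sum_list xs) = sum_list (map of_int xs)"
  by (induction xs) simp_all

text \<open>After expansion in coordinates, the permutation sum belonging to each choice of seven
  indices is the Levi-Civita symbol times \<open>vol7 vs\<close>, by the Leibniz formula. What is
  left is the integer contraction \<open>phi0_terms_cubic\<close>.\<close>

lemma phi0_cubic:
  assumes vs: "length vs = 7"
  shows "(\<Sum>\<pi> | \<pi> permutes {..<7}. of_int (sign \<pi>) * phi0 [X, vs ! \<pi> 0, vs ! \<pi> 1] *
      phi0 [Y, vs ! \<pi> 2, vs ! \<pi> 3] * phi0 [vs ! \<pi> 4, vs ! \<pi> 5, vs ! \<pi> 6])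
    = 144 * (X \<bullet> Y) * vol7 vs"
proof -
  let ?L = "[1..<8] :: nat list"
  \<comment> \<open>\<open>G a\<close> is \<open>phi0\<close> with the a-th basis vector in its
    first slot.\<close>
  define G :: "nat \<Rightarrow> real^7 \<Rightarrow> real^7 \<Rightarrow> real" where
    "G a u v = (\<Sum>t\<leftarrow>phi0_terms a. of_int (snd (snd t)) * (u $ of_nat (fst t) * v $ of_nat (fst (snd t))))"
    for a u v
  have G: "phi0 [x, u, v] = (\<Sum>a\<leftarrow>?L. x $ of_nat a * G a u v)" for x u v
    unfolding phi0_expand G_def sum_list_const_mult[symmetric]
    by (intro arg_cong[where f = sum_list] map_cong refl) (simp add: split_def)
  define P where "P \<pi> is = (\<Prod>r<7. vs ! \<pi> r $ (of_nat (is ! r) :: 7))" for \<pi> "is"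
  have P7: "P \<pi> [i,j,k,l,m,p,q] = vs ! \<pi> 0 $ of_nat i * vs ! \<pi> 1 $ of_nat j * vs ! \<pi> 2 $ of_nat k *
      vs ! \<pi> 3 $ of_nat l * vs ! \<pi> 4 $ of_nat m * vs ! \<pi> 5 $ of_nat p * vs ! \<pi> 6 $ of_nat q"
    for \<pi> i j k l m p q
    by (simp add: P_def lessThan_nat_numeral lessThan_Suc mult_ac)
  have P: "(\<Sum>\<pi> | \<pi> permutes {..<7}. of_int (sign \<pi>) * P \<pi> is) = of_int (inv_sign is) * vol7 vs"
    if "length is = 7" "set is \<subseteq> {1..7}" for "is"
  proof -
    have "map (\<lambda>r. \<chi> b. vs ! ix7 b $ (of_nat (is ! r) :: 7)) [0..<7]
        = map (\<lambda>k. \<chi> b. vs ! ix7 b $ of_nat k) is"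
      using that(1) by (intro nth_equalityI) auto
    then show ?thesis
      using det_form_columns[of ix7 vs "\<lambda>r. of_nat (is ! r)"] bij_ix7 vol7_columns[OF that vs]
      by (simp add: P_def vol7_def)
  qed
  \<comment> \<open>The coefficient of the a-th coordinate of \<open>X\<close> times the b-th
    coordinate of \<open>Y\<close>.\<close>
  define K where "K a b = (\<Sum>\<pi> | \<pi> permutes {..<7}. of_int (sign \<pi>) * (G a (vs ! \<pi> 0) (vs ! \<pi> 1) *
      G b (vs ! \<pi> 2) (vs ! \<pi> 3) *
      (\<Sum>c\<leftarrow>?L. vs ! \<pi> 4 $ of_nat c * G c (vs ! \<pi> 5) (vs ! \<pi> 6))))" for a b
  have K: "K a b = (if a = b then 144 else 0) * vol7 vs" if ab: "a \<in> set ?L" "b \<in> set ?L" for a b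
  proof -
    define ix where "ix t t' c t'' = [fst t, fst (snd t), fst t', fst (snd t'), c, fst t'', fst (snd t'')]"
      for t t' t'' :: "nat \<times> nat \<times> int" and c :: nat
    define S where "S t t' t'' = snd (snd t) * snd (snd t') * snd (snd t'')"
      for t t' t'' :: "nat \<times> nat \<times> int"
    have "K a b = (\<Sum>\<pi> | \<pi> permutes {..<7}. \<Sum>t\<leftarrow>phi0_terms a. \<Sum>t'\<leftarrow>phi0_terms b. \<Sum>c\<leftarrow>?L.
        \<Sum>t''\<leftarrow>phi0_terms c. of_int (S t t' t'') * (of_int (sign \<pi>) * P \<pi> (ix t t' c t'')))"
      unfolding K_def G_def sum_list_product
      by (intro sum.cong arg_cong[where f = sum_list] map_cong refl) (simp add: P7 ix_def S_def)
    also have "\<dots> = (\<Sum>t\<leftarrow>phi0_terms a. \<Sum>t'\<leftarrow>phi0_terms b. \<Sum>c\<leftarrow>?L. \<Sum>t''\<leftarrow>phi0_terms c.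
        of_int (S t t' t'') * (\<Sum>\<pi> | \<pi> permutes {..<7}. of_int (sign \<pi>) * P \<pi> (ix t t' c t'')))"
      unfolding sum_sum_list_swap sum_distrib_left ..
    also have "\<dots> = (\<Sum>t\<leftarrow>phi0_terms a. \<Sum>t'\<leftarrow>phi0_terms b. \<Sum>c\<leftarrow>?L. \<Sum>t''\<leftarrow>phi0_terms c.
        of_int (S t t' t'') * (of_int (inv_sign (ix t t' c t'')) * vol7 vs))"
    proof (intro arg_cong[where f = sum_list] map_cong refl)
      fix t t' c t''
      assume "t \<in> set (phi0_terms a)" "t' \<in> set (phi0_terms b)" "c \<in> set ?L"
        "t'' \<in> set (phi0_terms c)"
      then have "set (ix t t' c t'') \<subseteq> {1..7}"
        using phi0_terms_range[OF ab(1)] phi0_terms_range[OF ab(2)] phi0_terms_range[of c]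
        by (simp add: ix_def)
      then show "of_int (S t t' t'') * (\<Sum>\<pi> | \<pi> permutes {..<7}. of_int (sign \<pi>) * P \<pi> (ix t t' c t''))
          = of_int (S t t' t'') * (of_int (inv_sign (ix t t' c t'')) * vol7 vs)"
        by (subst P) (simp_all add: ix_def)
    qed
    also have "\<dots> = of_int (\<Sum>t\<leftarrow>phi0_terms a. \<Sum>t'\<leftarrow>phi0_terms b. \<Sum>c\<leftarrow>?L. \<Sum>t''\<leftarrow>phi0_terms c.
        S t t' t'' * inv_sign (ix t t' c t'')) * vol7 vs"
      by (simp add: of_int_sum_list o_def sum_list_mult_const flip: mult.assoc)
    also have "(\<Sum>t\<leftarrow>phi0_terms a. \<Sum>t'\<leftarrow>phi0_terms b. \<Sum>c\<leftarrow>?L. \<Sum>t''\<leftarrow>phi0_terms c.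
        S t t' t'' * inv_sign (ix t t' c t'')) =
       (\<Sum>(j,k,s)\<leftarrow>phi0_terms a. \<Sum>(l,m,t)\<leftarrow>phi0_terms b. if distinct [j,k,l,m]
        then \<Sum>c\<leftarrow>[1..<8]. if c \<in> {j,k,l,m} then 0
          else \<Sum>(p,q,r)\<leftarrow>phi0_terms c. s * t * r * inv_sign [j,k,l,m,c,p,q]
        else 0)"
    proof (unfold split_def, intro arg_cong[where f = sum_list] map_cong refl)
      fix t t' :: "nat \<times> nat \<times> int"
      define js where "js = [fst t, fst (snd t), fst t', fst (snd t')]"
      \<comment> \<open>The terms pruned in \<open>phi0_terms_cubic\<close> are exactly those with a
        repetition among the first five indices, where \<open>inv_sign\<close> vanishes.\<close>
      have 0: "inv_sign (ix t t' c t'') = 0" if "\<not> distinct js \<or> c \<in> set js" for c t''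
      proof (rule inv_sign_eq_0)
        have "ix t t' c t'' = js @ c # [fst t'', fst (snd t'')]" by (simp add: ix_def js_def)
        then show "\<not> distinct (ix t t' c t'')" using that by auto
      qed
      show "(\<Sum>c\<leftarrow>?L. \<Sum>t''\<leftarrow>phi0_terms c. S t t' t'' * inv_sign (ix t t' c t'')) =
        (if distinct [fst t, fst (snd t), fst t', fst (snd t')]
        then \<Sum>c\<leftarrow>[1..<8]. if c \<in> {fst t, fst (snd t), fst t', fst (snd t')} then 0
          else \<Sum>t''\<leftarrow>phi0_terms c. snd (snd t) * snd (snd t') * snd (snd t'') *
            inv_sign [fst t, fst (snd t), fst t', fst (snd t'), c, fst t'', fst (snd t'')]
        else 0)"
      proof (cases "distinct js")
        case True
        have "(\<Sum>t''\<leftarrow>phi0_terms c. S t t' t'' * inv_sign (ix t t' c t'')) =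
          (if c \<in> set js then 0 else \<Sum>t''\<leftarrow>phi0_terms c. snd (snd t) * snd (snd t') * snd (snd t'') *
            inv_sign [fst t, fst (snd t), fst t', fst (snd t'), c, fst t'', fst (snd t'')])" for c
          proof (cases "c \<in> set js")
            case True
            then show ?thesis by (simp add: 0)
          qed (simp add: S_def ix_def del: inv_sign.simps)
        then show ?thesis using True by (simp add: js_def del: inv_sign.simps)
      next
        case False
        then show ?thesis by (simp only: js_def[symmetric] if_False) (simp add: 0)
      qed
    qed
    also have "\<dots> = (if a = b then 144 else 0)"
      using phi0_terms_cubic ab unfolding list_all_iff by blast
    finally show ?thesis by simp
  qed
  have "(\<Sum>\<pi> | \<pi> permutes {..<7}. of_int (sign \<pi>) * phi0 [X, vs ! \<pi> 0, vs ! \<pi> 1] *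
      phi0 [Y, vs ! \<pi> 2, vs ! \<pi> 3] * phi0 [vs ! \<pi> 4, vs ! \<pi> 5, vs ! \<pi> 6])
    = (\<Sum>a\<leftarrow>?L. \<Sum>b\<leftarrow>?L. X $ of_nat a * Y $ of_nat b * K a b)"
  proof -
    have "of_int (sign \<pi>) * phi0 [X, vs ! \<pi> 0, vs ! \<pi> 1] *
        phi0 [Y, vs ! \<pi> 2, vs ! \<pi> 3] * phi0 [vs ! \<pi> 4, vs ! \<pi> 5, vs ! \<pi> 6]
      = (\<Sum>a\<leftarrow>?L. \<Sum>b\<leftarrow>?L. X $ of_nat a * Y $ of_nat b * (of_int (sign \<pi>) *
          (G a (vs ! \<pi> 0) (vs ! \<pi> 1) * G b (vs ! \<pi> 2) (vs ! \<pi> 3) *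
          (\<Sum>c\<leftarrow>?L. vs ! \<pi> 4 $ of_nat c * G c (vs ! \<pi> 5) (vs ! \<pi> 6)))))" for \<pi>
    proof -
      define r where "r = of_int (sign \<pi>) * (\<Sum>c\<leftarrow>?L. vs ! \<pi> 4 $ of_nat c * G c (vs ! \<pi> 5) (vs ! \<pi> 6))"
      define f where "f a = X $ of_nat a * G a (vs ! \<pi> 0) (vs ! \<pi> 1)" for a
      define g where "g b = Y $ of_nat b * G b (vs ! \<pi> 2) (vs ! \<pi> 3)" for b
      have "r * (sum_list (map f ?L) * sum_list (map g ?L)) = (\<Sum>a\<leftarrow>?L. \<Sum>b\<leftarrow>?L. r * (f a * g b))"
        by (simp only: mult.assoc sum_list_const_mult sum_list_mult_const)
      moreover have "(\<Sum>a\<leftarrow>?L. \<Sum>b\<leftarrow>?L. r * (f a * g b)) =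
        (\<Sum>a\<leftarrow>?L. \<Sum>b\<leftarrow>?L. X $ of_nat a * Y $ of_nat b * (of_int (sign \<pi>) *
          (G a (vs ! \<pi> 0) (vs ! \<pi> 1) * G b (vs ! \<pi> 2) (vs ! \<pi> 3) *
          (\<Sum>c\<leftarrow>?L. vs ! \<pi> 4 $ of_nat c * G c (vs ! \<pi> 5) (vs ! \<pi> 6)))))"
        unfolding r_def f_def g_def
        by (intro arg_cong[where f = sum_list] map_cong refl) (simp only: mult_ac)
      ultimately show ?thesis
        unfolding G[of X] G[of Y] G[of "vs ! \<pi> 4"] r_def f_def g_def by (simp only: mult_ac)
    qed
    then show ?thesis
      unfolding K_def sum_distrib_left
      by (simp only: sum_list_const_mult sum_sum_list_swap sum_distrib_left)
  qed
  also have "\<dots> = (\<Sum>a\<leftarrow>?L. X $ of_nat a * Y $ of_nat a * (144 * vol7 vs))"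
    by (simp add: K upt_conv_Cons)
  also have "\<dots> = 144 * (\<Sum>i<7. X $ of_nat (Suc i) * Y $ of_nat (Suc i)) * vol7 vs"
    by (simp add: upt_conv_Cons lessThan_nat_numeral lessThan_Suc algebra_simps)
  also have "(\<Sum>i<7. X $ of_nat (Suc i) * Y $ of_nat (Suc i)) = X \<bullet> Y"
    unfolding inner_vec_def inner_real_def by (rule sum.reindex_bij_betw[OF bij_of_nat_Suc])
  finally show ?thesis .
qed

section \<open>The metric and volume form of a pullback of \<open>phi0\<close>\<close>

lemma phi0_wedge:
  "wedge 4 3 (wedge 2 2 (contract X phi0) (contract Y phi0)) phi0 vs = 6 * (X \<bullet> Y) * vol7 vs"
proof (cases "length vs = 7")
  case True
  have u: "[0..<2] = [0,1::nat]" "[2..<4] = [2,3::nat]" "[4..<7] = [4,5,6::nat]"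
    by (simp_all add: upt_conv_Cons)
  \<comment> \<open>24 = 2! 2! 3! is the normalisation of the iterated wedge, and 144 / 24 = 6 is
    the constant in the identity that defines the metric.\<close>
  have "wedge 4 3 (wedge 2 2 (contract X phi0) (contract Y phi0)) phi0 vs = 144 * (X \<bullet> Y) * vol7 vs / 24"
    using wedge_wedge[of vs 2 2 3 "contract X phi0" "contract Y phi0" phi0] phi0_cubic[OF True, of X Y] True
    by (simp add: contract_def u fact_numeral)
  then show ?thesis by simp
next
  case False
  then show ?thesis by (simp add: wedge_def vol7_def det_form_def)
qed

lemma wedge_map:
  "wedge p q (\<lambda>vs. \<alpha> (map L vs)) (\<lambda>vs. \<beta> (map L vs)) vs = wedge p q \<alpha> \<beta> (map L vs)"
proof (cases "length vs = p + q")
  case True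
  have "\<pi> i < p + q" if "\<pi> permutes {..<p + q}" "i < p + q" for \<pi> i
    using permutes_in_image[OF that(1), of i] that(2) by simp
  then have "map L (map (\<lambda>i. vs ! \<pi> i) [0..<p]) = map (\<lambda>i. map L vs ! \<pi> i) [0..<p]"
    "map L (map (\<lambda>i. vs ! \<pi> i) [p..<p + q]) = map (\<lambda>i. map L vs ! \<pi> i) [p..<p + q]"
    if "\<pi> permutes {..<p + q}" for \<pi>
    using that True by auto
  then show ?thesis by (simp add: wedge_def True del: map_map map_eq_conv)
qed (simp add: wedge_def)

lemma covector_map:
  assumes "linear L" "covector k \<alpha>"
  shows "covector k (\<lambda>vs. \<alpha> (map L vs))"
  unfolding covector_def
proof (intro conjI allI impI)
  fix vs :: "'a list" and i
  assume "length vs = k" "i < k"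
  then have "linear (\<lambda>v. \<alpha> ((map L vs)[i := v]))"
    using assms(2) by (intro covector_linear) auto
  then have "linear ((\<lambda>v. \<alpha> ((map L vs)[i := v])) \<circ> L)"
    by (rule linear_compose[OF assms(1)])
  then show "linear (\<lambda>v. \<alpha> (map L (vs[i := v])))" by (simp add: o_def map_update)
next
  fix vs :: "'a list" and i j
  assume "length vs = k" "i < j" "j < k" "vs ! i = vs ! j"
  then have "\<not> distinct (map L vs)"
    using nth_eq_iff_index_eq[of "map L vs" i j] by auto
  then show "\<alpha> (map L vs) = 0" by (rule covector_repeated[OF assms(2)])
qed (simp add: covector_length[OF assms(2)])

lemma covector_scale:
  assumes "covector k \<alpha>"
  shows "\<alpha> (xs @ map ((*\<^sub>R) c) ys) = c ^ length ys * \<alpha> (xs @ ys)"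
proof (induction ys arbitrary: xs)
  case (Cons y ys)
  have "\<alpha> (xs @ c *\<^sub>R y # ys) = c * \<alpha> (xs @ y # ys)"
  proof (cases "Suc (length xs + length ys) = k")
    case True
    then show ?thesis using linear_scale[OF covector_linear_middle[OF assms]] by simp
  qed (use assms in \<open>simp add: covector_length\<close>)
  then show ?case using Cons.IH[of "xs @ [c *\<^sub>R y]"] by simp
qed simp

definition std_basis7 :: "(real^7) list" where
  "std_basis7 = map (\<lambda>i. axis (of_nat (Suc i)) 1) [0..<7]"

lemma vol7_std_basis7: "vol7 std_basis7 = 1"
proof -
  have "(\<chi> r. std_basis7 ! ix7 r) = mat 1"
    using of_nat_Suc_ix7 ix7_less by (simp add: vec_eq_iff std_basis7_def mat_def axis_def)
  then show ?thesis by (simp add: vol7_def det_form_def std_basis7_def)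
qed

lemma std_basis7_inner:
  assumes "i < 7" "j < 7"
  shows "std_basis7 ! i \<bullet> std_basis7 ! j = (if i = j then 1 else 0)"
proof -
  have "of_nat (Suc i) = (of_nat (Suc j) :: 7) \<longleftrightarrow> i = j"
    using assms ix7_of_nat_Suc by metis
  then show ?thesis using assms by (simp add: std_basis7_def inner_axis_axis del: of_nat_Suc)
qed

text \<open>The list supplies the rows, so applying \<open>L\<close> to each entry multiplies the
  matrix on the right by the transpose of \<open>matrix L\<close>.\<close>

lemma vol7_map:
  assumes "linear L"
  shows "vol7 (map L vs) = det (matrix L) * vol7 vs"
proof (cases "length vs = 7")
  case True
  have "(\<chi> r. map L vs ! ix7 r) = (\<chi> r. vs ! ix7 r) ** transpose (matrix L)"
  proof -
    have "map L vs ! ix7 r $ c = (\<Sum>k\<in>UNIV. vs ! ix7 r $ k * matrix L $ c $ k)" for r c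
    proof -
      have "L (vs ! ix7 r) = matrix L *v vs ! ix7 r" using assms by (simp add: matrix_works)
      then show ?thesis using ix7_less True by (simp add: matrix_vector_mult_def mult.commute)
    qed
    then show ?thesis
      by (simp add: vec_eq_iff matrix_matrix_mult_def transpose_def)
  qed
  then show ?thesis using True by (simp add: vol7_def det_form_def det_mul)
qed (simp add: vol7_def det_form_def)

lemma is_inner_product_map:
  assumes "linear L" "inj L"
  shows "is_inner_product (\<lambda>X Y. L X \<bullet> L Y)"
proof -
  have "L v \<noteq> 0" if "v \<noteq> 0" for v
    using assms that by (metis linear_0 injD)
  moreover have "bilinear (\<lambda>X Y. L X \<bullet> L Y)"
    unfolding bilinear_def using assms(1)
    by (auto intro!: linearI simp: linear_add linear_scale inner_simps)
  ultimately show ?thesis by (simp add: is_inner_product_def inner_commute)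
qed

text \<open>The images under \<open>L\<close> of an orthonormal list are the rows of an orthogonal
  matrix, whose determinant is 1 or -1.\<close>

lemma is_volume_form_vol7_map:
  fixes L :: "real^7 \<Rightarrow> real^7"
  assumes "linear L"
  shows "is_volume_form (\<lambda>X Y. L X \<bullet> L Y) (\<lambda>vs. vol7 (map L vs))"
  unfolding is_volume_form_def
proof (intro conjI allI impI)
  show "covector CARD(7) (\<lambda>vs. vol7 (map L vs))"
    using covector_map[OF assms covector_vol7] by simp
  fix es :: "(real^7) list"
  assume es: "length es = CARD(7)"
    "\<forall>i<CARD(7). \<forall>j<CARD(7). L (es ! i) \<bullet> L (es ! j) = (if i = j then 1 else 0)"
  define Q where "Q = (\<chi> r. map L es ! ix7 r)"
  have "Q ** transpose Q = mat 1"
  proof -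
    have "ix7 i = ix7 j \<longleftrightarrow> i = j" for i j by (metis of_nat_Suc_ix7)
    then have "(\<Sum>k\<in>UNIV. Q $ i $ k * Q $ j $ k) = (if i = j then 1 else 0)" for i j
      using es ix7_less by (simp add: Q_def inner_vec_def)
    then show ?thesis by (simp add: vec_eq_iff matrix_matrix_mult_def transpose_def mat_def)
  qed
  then have "det Q * det Q = 1" by (metis det_I det_mul det_transpose)
  then have "\<bar>det Q\<bar> = 1" by (metis abs_mult_self_eq abs_of_nonneg abs_square_eq_1 power2_eq_square)
  then show "\<bar>vol7 (map L es)\<bar> = 1" using es(1) by (simp add: vol7_def det_form_def Q_def)
qed

lemma phi0_map_wedge:
  "wedge 4 3 (wedge 2 2 (contract X (\<lambda>vs. phi0 (map L vs))) (contract Y (\<lambda>vs. phi0 (map L vs))))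
     (\<lambda>vs. phi0 (map L vs)) vs = 6 * (L X \<bullet> L Y) * vol7 (map L vs)"
proof -
  have "contract X (\<lambda>vs. phi0 (map L vs)) = (\<lambda>vs. contract (L X) phi0 (map L vs))" for X
    by (simp add: contract_def)
  moreover have "wedge 2 2 (\<lambda>vs. contract (L X) phi0 (map L vs)) (\<lambda>vs. contract (L Y) phi0 (map L vs))
      = (\<lambda>vs. wedge 2 2 (contract (L X) phi0) (contract (L Y) phi0) (map L vs))"
    by (rule ext) (rule wedge_map)
  ultimately show ?thesis by (simp only: wedge_map phi0_wedge)
qed

text \<open>
  If \<open>g\<close>, \<open>\<mu>\<close> is replaced by \<open>g / s\<close>, \<open>s \<mu>\<close>, then the volume of a \<open>g / s\<close>-orthonormal basis
  is multiplied by \<open>s\<^sup>9\<^sup>/\<^sup>2\<close>, so that the normalisation forces \<open>s = 1\<close>.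
\<close>

lemma g2_metric_vol_map:
  assumes L: "linear L" "inj L"
  shows "g2_metric_vol (\<lambda>vs. phi0 (map L vs)) = (\<lambda>X Y. L X \<bullet> L Y, \<lambda>vs. vol7 (map L vs))"
  unfolding g2_metric_vol_def
proof (rule the_equality)
  show "case (\<lambda>X Y. L X \<bullet> L Y, \<lambda>vs. vol7 (map L vs)) of (g, \<mu>) \<Rightarrow>
      is_inner_product g \<and> is_volume_form g \<mu> \<and>
      (\<forall>X Y vs. wedge 4 3 (wedge 2 2 (contract X (\<lambda>vs. phi0 (map L vs)))
        (contract Y (\<lambda>vs. phi0 (map L vs)))) (\<lambda>vs. phi0 (map L vs)) vs = 6 * g X Y * \<mu> vs)"
    unfolding split
    by (intro conjI allI is_inner_product_map[OF L] is_volume_form_vol7_map[OF L(1)] phi0_map_wedge)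
next
  fix P
  assume P: "case P of (g, \<mu>) \<Rightarrow>
      is_inner_product g \<and> is_volume_form g \<mu> \<and>
      (\<forall>X Y vs. wedge 4 3 (wedge 2 2 (contract X (\<lambda>vs. phi0 (map L vs)))
        (contract Y (\<lambda>vs. phi0 (map L vs)))) (\<lambda>vs. phi0 (map L vs)) vs = 6 * g X Y * \<mu> vs)"
  obtain g \<mu> where g\<mu>: "P = (g, \<mu>)" by (cases P)
  have g: "is_inner_product g" and \<mu>: "is_volume_form g \<mu>"
    and eq: "(L X \<bullet> L Y) * vol7 (map L vs) = g X Y * \<mu> vs" for X Y vs
    using P by (auto simp: g\<mu> phi0_map_wedge)
  have cov: "covector 7 \<mu>" using \<mu> by (simp add: is_volume_form_def)
  obtain L' where L': "linear L'" "\<And>v. L (L' v) = v"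
    using linear_injective_isomorphism[OF L] by blast
  \<comment> \<open>A list that is orthonormal and of volume 1 for the pullback pair. Evaluating
    \<open>eq\<close> on it gives \<open>L X \<bullet> L Y = s * g X Y\<close>, where
    \<open>s\<close> is its volume under \<mu>.\<close>
  define es where "es = map L' std_basis7"
  define s where "s = \<mu> es"
  have es: "map L es = std_basis7" "length es = 7" "L (es ! i) = std_basis7 ! i" if "i < 7" for i
    using that L' by (simp_all add: es_def o_def std_basis7_def)
  have gs: "L X \<bullet> L Y = s * g X Y" for X Y
    using eq[of X Y es] es(1)[of 0] by (simp add: vol7_std_basis7 s_def)
  have one: "s * g (es ! 0) (es ! 0) = 1"
    using gs[of "es ! 0" "es ! 0"] es(3)[of 0] std_basis7_inner[of 0 0] by simp
  then have "es ! 0 \<noteq> 0"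
    using g linear_0[OF bilinear_def[THEN iffD1, THEN conjunct1, THEN spec, of g 0]]
    by (auto simp: is_inner_product_def bilinear_lzero)
  then have "g (es ! 0) (es ! 0) > 0" using g by (simp add: is_inner_product_def)
  with one have s: "s > 0" by (metis zero_less_mult_pos2 zero_less_one)
  \<comment> \<open>The entries of \<open>es\<close> have \<open>g\<close>-length 1 / sqrt s, so
    this rescaling is \<open>g\<close>-orthonormal, and each of its seven factors sqrt s comes out
    of \<mu>.\<close>
  define fs where "fs = map ((*\<^sub>R) (sqrt s)) es"
  have "g (fs ! i) (fs ! j) = (if i = j then 1 else 0)" if "i < 7" "j < 7" for i j
  proof -
    have "g (fs ! i) (fs ! j) = s * g (es ! i) (es ! j)"
      using that es(2)[of 0] s g
      by (simp add: fs_def is_inner_product_def bilinear_lmul bilinear_rmul)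
    then show ?thesis
      using gs[of "es ! i" "es ! j"] es(3) that std_basis7_inner by simp
  qed
  then have "\<bar>\<mu> fs\<bar> = 1" using \<mu> es(2)[of 0] by (simp add: is_volume_form_def fs_def)
  moreover have "\<mu> fs = sqrt s ^ 7 * s"
    using covector_scale[OF cov, of "[]" "sqrt s" es] es(2)[of 0] by (simp add: fs_def s_def)
  ultimately have "sqrt s ^ 7 * s = 1" using s by simp
  moreover have "sqrt s ^ 9 = sqrt s ^ 7 * sqrt s ^ 2" by (simp flip: power_add)
  ultimately have "sqrt s ^ 9 = 1" using s by simp
  then have "sqrt s = 1" using s power_eq_iff_eq_base[of 9 "sqrt s" 1] by simp
  then have s1: "s = 1" by simp
  have g_eq: "g = (\<lambda>X Y. L X \<bullet> L Y)" using gs s1 by (simp add: fun_eq_iff)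
  moreover have "\<mu> = (\<lambda>vs. vol7 (map L vs))"
  proof
    show "\<mu> vs = vol7 (map L vs)" for vs
      using eq[of "es ! 0" "es ! 0" vs] one s1 g_eq by auto
  qed
  ultimately show "P = (\<lambda>X Y. L X \<bullet> L Y, \<lambda>vs. vol7 (map L vs))" by (simp add: g\<mu>)
qed

section \<open>Differentiability of the Hodge star\<close>

lemma covector_cmult: "covector k \<alpha> \<Longrightarrow> covector k (\<lambda>vs. c * \<alpha> vs)"
  unfolding covector_def
  by (auto intro: linear_compose_scale_right[where 'b = real, unfolded real_scaleR_def])

lemma covector_sum:
  assumes "\<And>i. i \<in> I \<Longrightarrow> covector k (f i)"
  shows "covector k (\<lambda>vs. \<Sum>i\<in>I. f i vs)"
  unfolding covector_def
proof (intro conjI allI impI)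
  fix vs :: "'b list" and i assume "length vs = k" "i < k"
  then show "linear (\<lambda>v. \<Sum>j\<in>I. f j (vs[i := v]))"
    by (intro linear_compose_sum ballI covector_linear[OF assms])
next
  fix vs :: "'b list" assume "length vs \<noteq> k"
  then show "(\<Sum>i\<in>I. f i vs) = 0" using assms covector_length by (intro sum.neutral) blast
next
  fix vs :: "'b list" and i j assume "length vs = k" "i < j" "j < k" "vs ! i = vs ! j"
  then have "\<not> distinct vs" using nth_eq_iff_index_eq[of vs i j] by auto
  then show "(\<Sum>i\<in>I. f i vs) = 0" using assms covector_repeated by (intro sum.neutral) blast
qed

lemma covector_append:
  assumes "covector (length us + k) \<mu>"
  shows "covector k (\<lambda>vs. \<mu> (us @ vs))"
  unfolding covector_def
proof (intro conjI allI impI)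
  fix vs :: "'a list" and i assume "length vs = k" "i < k"
  then show "linear (\<lambda>v. \<mu> (us @ vs[i := v]))"
    using covector_linear[OF assms, of "us @ vs" "length us + i"] by (simp add: list_update_append)
next
  fix vs :: "'a list" and i j assume "length vs = k" "i < j" "j < k" "vs ! i = vs ! j"
  then have "\<not> distinct (us @ vs)" using nth_eq_iff_index_eq[of vs i j] by auto
  then show "\<mu> (us @ vs) = 0" by (rule covector_repeated[OF assms])
qed (simp add: covector_length[OF assms])

text \<open>The star is a linear combination of copies of \<mu> with the first k slots filled, so
  multilinearity and alternation come from \<mu> alone, whatever \<open>g\<close> and \<beta>
  are.\<close>

lemma covector_hodge_star:
  fixes \<mu> :: "(real^'n::finite) list \<Rightarrow> real"
  assumes \<mu>: "covector CARD('n) \<mu>" and k: "k + l = CARD('n)"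
  shows "covector l (hodge_star g \<mu> k \<beta>)"
proof -
  have *: "covector l (\<lambda>vs. \<mu> (map (\<lambda>i. axis i 1) is @ vs))"
    if "length is = k" for "is" :: "'n list"
    by (rule covector_append) (use \<mu> k that in simp)
  have "covector l (\<lambda>vs. 1 / fact k * (\<Sum>is | length is = k. \<Sum>js | length js = k.
             (\<Prod>m<k. inverse_gram g $ (is ! m) $ (js ! m))
             * \<beta> (map (\<lambda>j. axis j 1) js) * \<mu> (map (\<lambda>i. axis i 1) is @ vs)))" (is "covector l ?h")
    by (intro covector_cmult covector_sum *) simp
  moreover have "?h = hodge_star g \<mu> k \<beta>"
  proof
    fix vs
    show "?h vs = hodge_star g \<mu> k \<beta> vs"
    proof (cases "length vs = l")
      case True
      then show ?thesis using k by (simp add: hodge_star_def)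
    next
      case False
      then have "?h vs = 0" by (rule covector_length[OF \<open>covector l ?h\<close>])
      then show ?thesis using False k by (auto simp: hodge_star_def)
    qed
  qed
  ultimately show ?thesis by simp
qed

definition in_phi0_orbit :: "((real^7) list \<Rightarrow> real) \<Rightarrow> bool" where
  "in_phi0_orbit \<phi> \<longleftrightarrow> (\<exists>L. linear L \<and> inj L \<and> \<phi> = (\<lambda>vs. phi0 (map L vs)))"

lemma covector_g2_star3:
  assumes "in_phi0_orbit \<phi>"
  shows "covector 4 (g2_star3 \<phi>)"
proof -
  obtain L where L: "linear L" "inj L" and \<phi>: "\<phi> = (\<lambda>vs. phi0 (map L vs))"
    using assms by (auto simp: in_phi0_orbit_def)
  have "covector CARD(7) (\<lambda>vs. vol7 (map L vs))"
    using is_volume_form_vol7_map[OF L(1)] by (simp add: is_volume_form_def)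
  then show ?thesis
    unfolding g2_star3_def \<phi> g2_metric_vol_map[OF L] snd_conv
    by (rule covector_hodge_star) simp
qed

section \<open>Differentiability of sums, quotients, determinants, inverses and roots\<close>

lemma differentiable_on_cong:
  assumes "f differentiable_on S" "\<And>x. x \<in> S \<Longrightarrow> f x = g x"
  shows "g differentiable_on S"
  using assms unfolding differentiable_on_def differentiable_def
  by (metis has_derivative_transform)

lemma differentiable_on_sum:
  assumes "finite I" "\<And>i. i \<in> I \<Longrightarrow> (\<lambda>x. f i x) differentiable_on S"
  shows "(\<lambda>x. \<Sum>i\<in>I. f i x) differentiable_on S"
  using assms unfolding differentiable_on_def by (auto intro: differentiable_sum)

lemma differentiable_on_prod:
  fixes f :: "'i \<Rightarrow> 'a::real_normed_vector \<Rightarrow> real"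
  assumes "\<And>i. i \<in> I \<Longrightarrow> (\<lambda>x. f i x) differentiable_on S"
  shows "(\<lambda>x. \<Prod>i\<in>I. f i x) differentiable_on S"
  using assms by (induction I rule: infinite_finite_induct) simp_all

lemma differentiable_on_divide:
  fixes f g :: "'a::real_normed_vector \<Rightarrow> real"
  assumes "f differentiable_on S" "g differentiable_on S" "\<And>x. x \<in> S \<Longrightarrow> g x \<noteq> 0"
  shows "(\<lambda>x. f x / g x) differentiable_on S"
  using assms unfolding differentiable_on_def by (auto intro: differentiable_divide)

lemma differentiable_on_wedge:
  fixes \<alpha> \<beta> :: "'a::real_normed_vector \<Rightarrow> 'v list \<Rightarrow> real"
  assumes "\<And>vs. (\<lambda>x. \<alpha> x vs) differentiable_on S" "\<And>vs. (\<lambda>x. \<beta> x vs) differentiable_on S"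
  shows "(\<lambda>x. wedge p q (\<alpha> x) (\<beta> x) vs) differentiable_on S"
proof (cases "length vs = p + q")
  case True
  then show ?thesis unfolding wedge_def
    by (simp only: simp_thms if_True)
      (intro differentiable_on_divide differentiable_on_sum differentiable_on_mult assms
        differentiable_on_const finite_permutations finite_lessThan; simp)
qed (simp add: wedge_def)

lemma differentiable_on_det:
  fixes A :: "'a::real_normed_vector \<Rightarrow> real^'n^'n"
  assumes "\<And>i j. (\<lambda>x. A x $ i $ j) differentiable_on S"
  shows "(\<lambda>x. det (A x)) differentiable_on S"
  unfolding det_def
  by (intro differentiable_on_sum differentiable_on_mult differentiable_on_prod assms
      differentiable_on_const finite_permutations finite)

text \<open>Cramer's rule applied to the j-th basis vector. It exhibits the entries of the inverse
  as quotients of determinants, which is how they are differentiated.\<close>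

lemma matrix_inv_cramer:
  fixes A :: "real^'n^'n"
  assumes "det A \<noteq> 0"
  shows "matrix_inv A $ i $ j = det (\<chi> a b. if b = i then axis j 1 $ a else A $ a $ b) / det A"
proof -
  have "\<exists>B. A ** B = mat 1 \<and> B ** A = mat 1"
    using assms unfolding invertible_det_nz[symmetric] invertible_def .
  then have "A ** matrix_inv A = mat 1" unfolding matrix_inv_def by (rule someI2_ex) blast
  then have "A *v (matrix_inv A *v axis j 1) = axis j 1" by (simp add: matrix_vector_mul_assoc)
  then have "matrix_inv A *v axis j 1 =
      (\<chi> k. det (\<chi> a b. if b = k then axis j 1 $ a else A $ a $ b) / det A)"
    using cramer[OF assms] by simp
  then have "(matrix_inv A *v axis j 1) $ i = det (\<chi> a b. if b = i then axis j 1 $ a else A $ a $ b) / det A"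
    by simp
  then show ?thesis by (simp add: matrix_vector_mult_basis column_def)
qed

lemma differentiable_on_matrix_inv:
  fixes A :: "'a::real_normed_vector \<Rightarrow> real^'n^'n"
  assumes "\<And>i j. (\<lambda>x. A x $ i $ j) differentiable_on S" "\<And>x. x \<in> S \<Longrightarrow> det (A x) \<noteq> 0"
  shows "(\<lambda>x. matrix_inv (A x) $ i $ j) differentiable_on S"
proof (rule differentiable_on_cong)
  have "(\<lambda>x. (\<chi> a b. if b = i then axis j 1 $ a else A x $ a $ b) $ a $ b) differentiable_on S" for a b
    using assms(1) by (cases "b = i") simp_all
  then show "(\<lambda>x. det (\<chi> a b. if b = i then axis j 1 $ a else A x $ a $ b) / det (A x)) differentiable_on S"
    by (intro differentiable_on_divide differentiable_on_det assms)
qed (simp add: matrix_inv_cramer assms(2))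

text \<open>An odd root is differentiable on both sides of 0, as is needed for a volume whose sign
  is not known.\<close>

lemma differentiable_on_odd_root:
  fixes f :: "'a::real_normed_vector \<Rightarrow> real"
  assumes "f differentiable_on S" "\<And>x. x \<in> S \<Longrightarrow> f x \<noteq> 0" "odd n"
  shows "(\<lambda>x. root n (f x)) differentiable_on S"
  unfolding differentiable_on_def
proof
  fix x assume x: "x \<in> S"
  have "root n differentiable (at (f x))"
    using DERIV_odd_real_root[OF assms(3) assms(2)[OF x]] real_differentiable_def by blast
  then have "root n differentiable (at (f x) within f ` S)" by (rule differentiable_at_withinI)
  then show "(\<lambda>x. root n (f x)) differentiable (at x within S)"
    using differentiable_chain_within[of f x S "root n"] assms(1) x
    by (simp add: o_def differentiable_on_def)
qed

lemma differentiable_on_hodge_star: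
  fixes g :: "'a::real_normed_vector \<Rightarrow> real^'n::finite \<Rightarrow> real^'n \<Rightarrow> real"
  assumes "\<And>i j. (\<lambda>x. inverse_gram (g x) $ i $ j) differentiable_on S"
    and "\<And>vs. (\<lambda>x. \<beta> x vs) differentiable_on S" "\<And>vs. (\<lambda>x. \<mu> x vs) differentiable_on S"
  shows "(\<lambda>x. hodge_star (g x) (\<mu> x) k (\<beta> x) vs) differentiable_on S"
proof (cases "k + length vs = CARD('n)")
  case True
  have "finite {is :: 'n list. length is = k}" by (rule finite_list_length)
  then show ?thesis
    using True unfolding hodge_star_def
    by (simp only: simp_thms if_True)
      (intro differentiable_on_divide differentiable_on_sum differentiable_on_mult
        differentiable_on_prod assms differentiable_on_const; simp)
qed (simp add: hodge_star_def)

lemma differentiable_on_g2_star3: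
  fixes \<phi> :: "'a::real_normed_vector \<Rightarrow> (real^7) list \<Rightarrow> real"
  assumes orbit: "\<And>x. x \<in> S \<Longrightarrow> in_phi0_orbit (\<phi> x)"
    and diff: "\<And>vs. (\<lambda>x. \<phi> x vs) differentiable_on S"
  shows "(\<lambda>x. g2_star3 (\<phi> x) vs) differentiable_on S"
proof -
  obtain L where L: "linear (L x)" "inj (L x)" and \<phi>: "\<phi> x = (\<lambda>vs. phi0 (map (L x) vs))"
    if "x \<in> S" for x
    using orbit unfolding in_phi0_orbit_def by metis
  define B where "B x X Y = wedge 4 3 (wedge 2 2 (contract X (\<phi> x)) (contract Y (\<phi> x))) (\<phi> x) std_basis7 / 6"
    for x X Y
  \<comment> \<open>The value of the volume form on the standard basis; it may be negative.\<close>
  define m where "m x = det (matrix (L x))" for x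
  \<comment> \<open>Built from \<open>B\<close> and \<open>m\<close> rather than from
    \<open>L\<close>, so that its regularity can be read off; on \<open>S\<close> it is the pullback
    metric.\<close>
  define g where "g x = (\<lambda>X Y. B x X Y / m x)" for x
  define \<mu> where "\<mu> x = (\<lambda>vs. m x * vol7 vs)" for x
  have B: "B x X Y = (L x X \<bullet> L x Y) * m x" if "x \<in> S" for x X Y
    using that unfolding B_def \<phi>[OF that] phi0_map_wedge
    by (simp add: vol7_map L vol7_std_basis7 m_def)
  have m0: "m x \<noteq> 0" if "x \<in> S" for x
    using L[OF that] det_nz_iff_inj by (auto simp: m_def)
  have g: "g x = (\<lambda>X Y. L x X \<bullet> L x Y)" if "x \<in> S" for x
    using m0[OF that] by (simp add: g_def B[OF that])
  have gram: "(\<chi> i j. g x (axis i 1) (axis j 1)) = transpose (matrix (L x)) ** matrix (L x)"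
    if "x \<in> S" for x
    by (simp add: g[OF that] vec_eq_iff matrix_matrix_mult_def transpose_def matrix_def inner_vec_def)
  have mB: "m x = root 9 (det (\<chi> i j. B x (axis i 1) (axis j 1)))" if "x \<in> S" for x
  proof -
    have s: "det (\<chi> i. m x *s A $ i) = m x ^ 7 * det A" for A :: "real^7^7"
      by (simp add: det_rows_mul)
    have "(\<chi> i j. B x (axis i 1) (axis j 1)) = (\<chi> i. m x *s (\<chi> i j. g x (axis i 1) (axis j 1)) $ i)"
      using m0[OF that] by (simp add: g_def vec_eq_iff)
    then have "det (\<chi> i j. B x (axis i 1) (axis j 1)) = m x ^ 7 * (m x * m x)"
      by (simp only: s gram[OF that] det_mul det_transpose m_def[symmetric])
    then have "det (\<chi> i j. B x (axis i 1) (axis j 1)) = m x ^ 9"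
      by (simp add: power_numeral_reduce)
    then show ?thesis by (simp add: odd_real_root_power_cancel)
  qed
  have dB: "(\<lambda>x. B x X Y) differentiable_on S" for X Y
    unfolding B_def
    by (intro differentiable_on_divide differentiable_on_wedge differentiable_on_const diff)
      (simp_all add: contract_def diff)
  have "(\<lambda>x. det (\<chi> i j. B x (axis i 1) (axis j 1))) differentiable_on S"
    by (rule differentiable_on_det) (simp add: dB)
  then have "(\<lambda>x. root 9 (det (\<chi> i j. B x (axis i 1) (axis j 1)))) differentiable_on S"
    \<comment> \<open>The determinant is nonzero because its ninth root is
      \<open>m x\<close>.\<close>
    by (rule differentiable_on_odd_root) (use mB m0 in force)+
  then have dm: "m differentiable_on S"
    by (rule differentiable_on_cong) (simp add: mB)
  have dg: "(\<lambda>x. g x X Y) differentiable_on S" for X Y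
    unfolding g_def by (intro differentiable_on_divide dB dm m0)
  have "det (\<chi> i j. g x (axis i 1) (axis j 1)) \<noteq> 0" if "x \<in> S" for x
    using m0[OF that] by (simp add: gram[OF that] det_mul m_def)
  then have "(\<lambda>x. inverse_gram (g x) $ i $ j) differentiable_on S" for i j
    unfolding inverse_gram_def by (intro differentiable_on_matrix_inv) (simp_all add: dg)
  moreover have "(\<lambda>x. \<mu> x vs) differentiable_on S" for vs
    unfolding \<mu>_def by (intro differentiable_on_mult dm differentiable_on_const)
  ultimately have "(\<lambda>x. hodge_star (g x) (\<mu> x) 3 (\<phi> x) vs) differentiable_on S"
    by (intro differentiable_on_hodge_star diff)
  moreover have "hodge_star (g x) (\<mu> x) 3 (\<phi> x) vs = g2_star3 (\<phi> x) vs" if "x \<in> S" for x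
    unfolding g2_star3_def \<phi>[OF that] g2_metric_vol_map[OF L[OF that]] g[OF that] fst_conv snd_conv
    by (simp add: \<mu>_def vol7_map L that m_def)
  ultimately show ?thesis by (rule differentiable_on_cong)
qed

section \<open>Exterior and Lie derivatives in a chart\<close>

lemma frechet_derivative_eqI: "(f has_derivative f') (at x) \<Longrightarrow> frechet_derivative f (at x) = f'"
  using frechet_derivative_at by metis

text \<open>\<open>frechet_derivative\<close> is a choice among all derivatives. Functions that
  agree near \<open>x\<close> have the same derivatives there, hence the same choice, even where
  none exists.\<close>

lemma frechet_derivative_cong_open:
  assumes "open S" "x \<in> S" "\<And>y. y \<in> S \<Longrightarrow> f y = g y"
  shows "frechet_derivative f (at x) = frechet_derivative g (at x)"
proof -
  have "(f has_derivative f') (at x) \<longleftrightarrow> (g has_derivative f') (at x)" for f'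
    using assms by (metis has_derivative_transform_within_open)
  then show ?thesis by (simp add: frechet_derivative_def)
qed

lemma frechet_derivative_0_open:
  assumes "open S" "x \<in> S" "\<And>y. y \<in> S \<Longrightarrow> f y = 0"
  shows "frechet_derivative f (at x) = (\<lambda>_. 0)"
  using frechet_derivative_cong_open[OF assms] frechet_derivative_eqI[OF has_derivative_const] by simp

section \<open>Symmetry of second derivatives\<close>

lemma DERIV_along_line:
  fixes f :: "'a::euclidean_space \<Rightarrow> real"
  assumes "f differentiable at (p + s *\<^sub>R a)"
  shows "((\<lambda>s. f (p + s *\<^sub>R a)) has_real_derivative frechet_derivative f (at (p + s *\<^sub>R a)) a) (at s)"
proof -
  let ?D = "frechet_derivative f (at (p + s *\<^sub>R a))"
  have D: "(f has_derivative ?D) (at (p + s *\<^sub>R a))"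
    using assms by (simp add: frechet_derivative_works)
  have "((\<lambda>s. p + s *\<^sub>R a) has_derivative (\<lambda>t. t *\<^sub>R a)) (at s)"
    by (auto intro!: derivative_eq_intros)
  from diff_chain_at[OF this D] have "((\<lambda>s. f (p + s *\<^sub>R a)) has_derivative (\<lambda>t. ?D (t *\<^sub>R a))) (at s)"
    by (simp add: o_def)
  moreover have "?D (t *\<^sub>R a) = t * ?D a" for t
    using linear_scale[OF has_derivative_linear[OF D]] by simp
  ultimately show ?thesis by (simp add: has_field_derivative_def mult.commute[of _ "?D a"])
qed

text \<open>The mean value theorem twice: along \<open>a\<close> for the difference of
  \<open>f\<close> and its translate by h b, then along \<open>b\<close> for the resulting
  derivative. The left side is symmetric in \<open>a\<close> and \<open>b\<close>.\<close>

lemma second_difference: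
  fixes f :: "'a::euclidean_space \<Rightarrow> real"
  assumes h: "h > 0" and S: "open S" "\<And>s t. 0 \<le> s \<Longrightarrow> s \<le> h \<Longrightarrow> 0 \<le> t \<Longrightarrow> t \<le> h \<Longrightarrow> x + s *\<^sub>R a + t *\<^sub>R b \<in> S"
    and f: "f differentiable_on S" "(\<lambda>y. frechet_derivative f (at y) a) differentiable_on S"
  shows "\<exists>s t. 0 \<le> s \<and> s \<le> h \<and> 0 \<le> t \<and> t \<le> h \<and>
    f (x + h *\<^sub>R a + h *\<^sub>R b) - f (x + h *\<^sub>R a) - f (x + h *\<^sub>R b) + f x =
    h * h * frechet_derivative (\<lambda>y. frechet_derivative f (at y) a) (at (x + s *\<^sub>R a + t *\<^sub>R b)) b"
proof -
  let ?fa = "\<lambda>y. frechet_derivative f (at y) a"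
  have diff: "f differentiable at y" "?fa differentiable at y" if "y \<in> S" for y
    using f S(1) that by (simp_all add: differentiable_on_eq_differentiable_at)
  define \<phi> where "\<phi> s = f ((x + h *\<^sub>R b) + s *\<^sub>R a) - f (x + s *\<^sub>R a)" for s
  have "(\<phi> has_real_derivative ?fa ((x + h *\<^sub>R b) + s *\<^sub>R a) - ?fa (x + s *\<^sub>R a)) (at s)"
    if "0 \<le> s" "s \<le> h" for s
    unfolding \<phi>_def using S(2)[of s h] S(2)[of s 0] that h
    by (intro DERIV_diff DERIV_along_line diff) (simp_all add: algebra_simps)
  then obtain s where s: "0 < s" "s < h"
    "\<phi> h - \<phi> 0 = (h - 0) * (?fa ((x + h *\<^sub>R b) + s *\<^sub>R a) - ?fa (x + s *\<^sub>R a))"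
    using MVT2[OF h, of \<phi> "\<lambda>s. ?fa ((x + h *\<^sub>R b) + s *\<^sub>R a) - ?fa (x + s *\<^sub>R a)"] by blast
  have "((\<lambda>t. ?fa ((x + s *\<^sub>R a) + t *\<^sub>R b)) has_real_derivative
      frechet_derivative ?fa (at ((x + s *\<^sub>R a) + t *\<^sub>R b)) b) (at t)" if "0 \<le> t" "t \<le> h" for t
    using S(2)[of s t] that s by (intro DERIV_along_line diff) simp
  then obtain t where t: "0 < t" "t < h"
    "?fa ((x + s *\<^sub>R a) + h *\<^sub>R b) - ?fa ((x + s *\<^sub>R a) + 0 *\<^sub>R b) =
      (h - 0) * frechet_derivative ?fa (at ((x + s *\<^sub>R a) + t *\<^sub>R b)) b"
    using MVT2[OF h, of "\<lambda>t. ?fa ((x + s *\<^sub>R a) + t *\<^sub>R b)"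
        "\<lambda>t. frechet_derivative ?fa (at ((x + s *\<^sub>R a) + t *\<^sub>R b)) b"] by blast
  have c: "(x + h *\<^sub>R b) + s *\<^sub>R a = (x + s *\<^sub>R a) + h *\<^sub>R b" for s by (simp add: algebra_simps)
  have "f (x + h *\<^sub>R a + h *\<^sub>R b) - f (x + h *\<^sub>R a) - f (x + h *\<^sub>R b) + f x = \<phi> h - \<phi> 0"
    by (simp add: \<phi>_def c)
  also have "\<dots> = h * h * frechet_derivative ?fa (at (x + s *\<^sub>R a + t *\<^sub>R b)) b"
    using s(3) t(3) by (simp add: c)
  finally show ?thesis using s t by (intro exI[of _ s] exI[of _ t]) simp
qed

text \<open>The symmetric second difference equals h^2 times either mixed derivative at suitable
  points near \<open>x\<close>. Continuity of both then forbids a gap between them at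
  \<open>x\<close>.\<close>

lemma second_derivative_symmetric:
  fixes f :: "'a::euclidean_space \<Rightarrow> real"
  assumes S: "open S" "x \<in> S" and f: "Ck_on 2 f S"
  shows "frechet_derivative (\<lambda>y. frechet_derivative f (at y) a) (at x) b =
    frechet_derivative (\<lambda>y. frechet_derivative f (at y) b) (at x) a"
proof (rule ccontr)
  define F where "F a b y = frechet_derivative (\<lambda>y. frechet_derivative f (at y) a) (at y) b" for a b y
  assume "\<not> ?thesis"
  then have ne: "\<bar>F a b x - F b a x\<bar> > 0" by (simp add: F_def)
  \<comment> \<open>Half the gap: two approximations with error below \<open>e\<close> contradict
    it.\<close>
  define e where "e = \<bar>F a b x - F b a x\<bar> / 2"
  have e: "e > 0" using ne by (simp add: e_def)
  have f1: "f differentiable_on S" and f2: "(\<lambda>y. frechet_derivative f (at y) v) differentiable_on S"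
    and f3: "continuous_on S (F u v)" for u v
    using f by (simp_all add: numeral_2_eq_2 F_def)
  have "\<exists>d>0. \<forall>y. dist y x < d \<longrightarrow> y \<in> S \<and> \<bar>F u v y - F u v x\<bar> < e" for u v
  proof -
    obtain d1 where "d1 > 0" "\<And>y. dist y x < d1 \<Longrightarrow> y \<in> S"
      using S by (metis open_dist)
    moreover obtain d2 where "d2 > 0" "\<And>y. y \<in> S \<Longrightarrow> dist y x < d2 \<Longrightarrow> dist (F u v y) (F u v x) < e"
      using f3[of u v] e S(2) unfolding continuous_on_iff by metis
    ultimately show ?thesis by (intro exI[of _ "min d1 d2"]) (auto simp: dist_real_def)
  qed
  then obtain d where d: "\<And>u v. d u v > 0" "\<And>u v y. dist y x < d u v \<Longrightarrow> y \<in> S"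
    "\<And>u v y. dist y x < d u v \<Longrightarrow> \<bar>F u v y - F u v x\<bar> < e" by metis
  define r where "r = min (d a b) (d b a)"
  have r: "r > 0" using d(1) by (simp add: r_def)
  \<comment> \<open>Chosen so that \<open>h * N * 2 = r\<close> below: every point used by the
    second difference then stays in the ball where both mixed derivatives vary by less than
    \<open>e\<close>.\<close>
  define N where "N = norm a + norm b + 1"
  define h where "h = r / (2 * N)"
  have pos: "N > 0" using norm_ge_zero[of a] norm_ge_zero[of b] unfolding N_def by linarith
  have h: "h > 0" using r pos by (simp add: h_def)
  have close: "dist (x + s *\<^sub>R u + t *\<^sub>R v) x < r"
    if "0 \<le> s" "s \<le> h" "0 \<le> t" "t \<le> h" "(u, v) \<in> {(a, b), (b, a)}" for s t u v
  proof -
    have "dist (x + s *\<^sub>R u + t *\<^sub>R v) x = norm (s *\<^sub>R u + t *\<^sub>R v)"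
      by (simp add: dist_norm add.assoc)
    also have "\<dots> \<le> s * norm u + t * norm v"
      using norm_triangle_ineq[of "s *\<^sub>R u" "t *\<^sub>R v"] that by simp
    also have "\<dots> \<le> h * norm u + h * norm v"
      using that by (intro add_mono mult_right_mono) auto
    also have "\<dots> = h * (norm a + norm b)" using that(5) by (auto simp: algebra_simps)
    also have "\<dots> < h * N * 2"
      using h by (simp add: N_def algebra_simps add_nonneg_pos)
    also have "\<dots> = r" using pos by (simp add: h_def)
    finally show ?thesis .
  qed
  have inS: "x + s *\<^sub>R u + t *\<^sub>R v \<in> S" 
    if "0 \<le> s" "s \<le> h" "0 \<le> t" "t \<le> h" "(u, v) \<in> {(a, b), (b, a)}" for s t u v
    using close[OF that] d(2)[of _ a b] by (simp add: r_def)
  obtain s t where st: "0 \<le> s" "s \<le> h" "0 \<le> t" "t \<le> h"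
    "f (x + h *\<^sub>R a + h *\<^sub>R b) - f (x + h *\<^sub>R a) - f (x + h *\<^sub>R b) + f x =
      h * h * F a b (x + s *\<^sub>R a + t *\<^sub>R b)"
    using second_difference[OF h S(1) inS f1 f2, of a b] unfolding F_def by auto
  obtain s' t' where st': "0 \<le> s'" "s' \<le> h" "0 \<le> t'" "t' \<le> h"
    "f (x + h *\<^sub>R b + h *\<^sub>R a) - f (x + h *\<^sub>R b) - f (x + h *\<^sub>R a) + f x =
      h * h * F b a (x + s' *\<^sub>R b + t' *\<^sub>R a)"
    using second_difference[OF h S(1) inS f1 f2, of b a] unfolding F_def by auto
  have "x + h *\<^sub>R b + h *\<^sub>R a = x + h *\<^sub>R a + h *\<^sub>R b" by (simp add: algebra_simps)
  then have "h * h * F a b (x + s *\<^sub>R a + t *\<^sub>R b) = h * h * F b a (x + s' *\<^sub>R b + t' *\<^sub>R a)"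
    using st(5) st'(5) by (simp add: algebra_simps)
  then have "F a b (x + s *\<^sub>R a + t *\<^sub>R b) = F b a (x + s' *\<^sub>R b + t' *\<^sub>R a)" using h by simp
  moreover have "\<bar>F a b (x + s *\<^sub>R a + t *\<^sub>R b) - F a b x\<bar> < e"
    using close[OF st(1-4), of a b] by (intro d(3)) (simp add: r_def)
  moreover have "\<bar>F b a (x + s' *\<^sub>R b + t' *\<^sub>R a) - F b a x\<bar> < e"
    using close[OF st'(1-4), of b a] by (intro d(3)) (simp add: r_def)
  ultimately have "\<bar>F a b x - F b a x\<bar> < 2 * e" by linarith
  then show False by (simp add: e_def)
qed

section \<open>d d = 0 in a chart\<close>

definition omit :: "nat \<Rightarrow> 'v list \<Rightarrow> 'v list" where
  "omit i vs = take i vs @ drop (Suc i) vs"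

lemma length_omit [simp]: "i < length vs \<Longrightarrow> length (omit i vs) = length vs - 1"
  by (simp add: omit_def)

lemma nth_omit: "i < length vs \<Longrightarrow> j < length vs - 1 \<Longrightarrow> omit i vs ! j = vs ! (if j < i then j else Suc j)"
  by (auto simp: omit_def nth_append)

text \<open>After entry i is removed, position j with i \<le> j holds the original entry Suc j. This
  is the simplicial identity that pairs the terms of d d.\<close>

lemma omit_omit:
  assumes "i \<le> j" "j < length vs - 1"
  shows "omit j (omit i vs) = omit i (omit (Suc j) vs)"
  using assms by (intro nth_equalityI) (simp_all add: nth_omit)

text \<open>The formula of \<open>ext_d\<close> as an operator on functions of the coordinates, with
  no chart left in it.\<close>

definition local_d :: "('v::euclidean_space \<Rightarrow> 'v list \<Rightarrow> real) \<Rightarrow> 'v \<Rightarrow> 'v list \<Rightarrow> real" where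
  "local_d \<omega> x vs = (\<Sum>i<length vs. (-1) ^ i *
     frechet_derivative (\<lambda>y. \<omega> y (omit i vs)) (at x) (vs ! i))"

lemma local_d_cong_open:
  assumes "open S" "x \<in> S" "\<And>y vs. y \<in> S \<Longrightarrow> \<omega> y vs = \<eta> y vs"
  shows "local_d \<omega> x vs = local_d \<eta> x vs"
proof -
  have "frechet_derivative (\<lambda>y. \<omega> y ws) (at x) = frechet_derivative (\<lambda>y. \<eta> y ws) (at x)" for ws
    using assms by (intro frechet_derivative_cong_open) auto
  then show ?thesis by (simp add: local_d_def)
qed

text \<open>Each pair of removed positions occurs twice, once for each order of removal. The two
  second derivatives agree by symmetry, and the signs differ because removing the earlier entry
  first shifts the later one by one place.\<close>

lemma local_d_local_d:
  assumes S: "open S" "x \<in> S" and \<omega>: "\<And>vs. Ck_on 2 (\<lambda>y. \<omega> y vs) S"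
  shows "local_d (local_d \<omega>) x vs = 0"
proof -
  define n where "n = length vs"
  define H where "H us a b = frechet_derivative (\<lambda>y. frechet_derivative (\<lambda>z. \<omega> z us) (at y) a) (at x) b"
    for us a b
  have sym: "H us a b = H us b a" for us a b
    unfolding H_def by (rule second_derivative_symmetric[OF S \<omega>])
  have diff: "(\<lambda>y. frechet_derivative (\<lambda>z. \<omega> z us) (at y) a) differentiable at x" for us a
    using \<omega>[of us] S by (simp add: numeral_2_eq_2 differentiable_on_eq_differentiable_at)
  \<comment> \<open>The term indexed by the original positions p < q of the two removed
    entries.\<close>
  define T where "T = (\<lambda>(p, q). (-1) ^ (p + q) * H (omit p (omit q vs)) (vs ! p) (vs ! q))"
  have inner: "frechet_derivative (\<lambda>y. local_d \<omega> y us) (at x) b =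
      (\<Sum>j<length us. (-1) ^ j * H (omit j us) (us ! j) b)" for us b
  proof -
    have "((\<lambda>y. local_d \<omega> y us) has_derivative (\<lambda>b. \<Sum>j<length us. (-1) ^ j * H (omit j us) (us ! j) b)) (at x)"
      unfolding local_d_def H_def
      by (intro has_derivative_sum has_derivative_mult_right)
        (use diff in \<open>simp add: frechet_derivative_works\<close>)
    then show ?thesis by (simp add: frechet_derivative_eqI)
  qed
  have "local_d (local_d \<omega>) x vs = (\<Sum>i<n. \<Sum>j<n - 1.
      (-1) ^ (i + j) * H (omit j (omit i vs)) (omit i vs ! j) (vs ! i))"
    unfolding local_d_def[of "local_d \<omega>"] inner n_def
    by (intro sum.cong refl) (simp add: sum_distrib_left power_add mult.assoc)
  also have "\<dots> = (\<Sum>(i, j)\<in>{..<n} \<times> {..<n - 1}.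
      (-1) ^ (i + j) * H (omit j (omit i vs)) (omit i vs ! j) (vs ! i))"
    by (simp add: sum.cartesian_product)
  also have "{..<n} \<times> {..<n - 1} = {(i, j). j < i \<and> i < n} \<union> {(i, j). i \<le> j \<and> j < n - 1}" (is "_ = ?A \<union> ?B")
    by auto
  also have "(\<Sum>(i, j)\<in>?A \<union> ?B. (-1) ^ (i + j) * H (omit j (omit i vs)) (omit i vs ! j) (vs ! i))
    = (\<Sum>(i, j)\<in>?A. (-1) ^ (i + j) * H (omit j (omit i vs)) (omit i vs ! j) (vs ! i))
    + (\<Sum>(i, j)\<in>?B. (-1) ^ (i + j) * H (omit j (omit i vs)) (omit i vs ! j) (vs ! i))"
  proof (rule sum.union_disjoint)
    show "finite ?A" by (rule finite_subset[of _ "{..<n} \<times> {..<n}"]) auto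
    show "finite ?B" by (rule finite_subset[of _ "{..<n} \<times> {..<n}"]) auto
  qed auto
  also have "(\<Sum>(i, j)\<in>?A. (-1) ^ (i + j) * H (omit j (omit i vs)) (omit i vs ! j) (vs ! i))
      = (\<Sum>(i, j)\<in>?A. T (j, i))"
    by (intro sum.cong refl) (auto simp: T_def nth_omit n_def add.commute)
  also have "(\<Sum>(i, j)\<in>?B. (-1) ^ (i + j) * H (omit j (omit i vs)) (omit i vs ! j) (vs ! i))
      = (\<Sum>(i, j)\<in>?B. - T (i, Suc j))"
    by (intro sum.cong refl) (auto simp: T_def nth_omit n_def omit_omit sym)
  also have "\<dots> = (\<Sum>(i, j)\<in>?A. - T (j, i))"
    \<comment> \<open>The pair (i, j) with i \<le> j removes the original positions i and Suc j, as
      does the pair (Suc j, i) of the other half.\<close>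
    by (rule sum.reindex_bij_witness[of _ "\<lambda>(i, j). (j, i - 1)" "\<lambda>(i, j). (Suc j, i)"]) auto
  finally show ?thesis by (simp add: split_def sum_negf)
qed

section \<open>Cartan's formula in a chart\<close>

definition local_lie ::
  "('v::euclidean_space \<Rightarrow> 'v) \<Rightarrow> ('v \<Rightarrow> 'v list \<Rightarrow> real) \<Rightarrow> 'v \<Rightarrow> 'v list \<Rightarrow> real" where
  "local_lie X \<omega> x vs = frechet_derivative (\<lambda>y. \<omega> y vs) (at x) (X x)
     + (\<Sum>i<length vs. \<omega> x (vs[i := frechet_derivative X (at x) (vs ! i)]))"

text \<open>The product rule for the pairing of the two variable objects. Linearity of
  \<open>\<omega> y\<close> in its first slot, at every y near x, turns the pairing into a finite
  sum of products over \<open>Basis\<close>.\<close>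

lemma frechet_derivative_contract:
  fixes \<omega> :: "'v::euclidean_space \<Rightarrow> 'v list \<Rightarrow> real"
  assumes S: "open S" "x \<in> S" and \<omega>: "\<And>y. y \<in> S \<Longrightarrow> covector (Suc (length ws)) (\<omega> y)"
    and diff: "\<And>vs. (\<lambda>y. \<omega> y vs) differentiable at x" "X differentiable at x"
  shows "frechet_derivative (\<lambda>y. \<omega> y (X y # ws)) (at x) h =
    frechet_derivative (\<lambda>y. \<omega> y (X x # ws)) (at x) h + \<omega> x (frechet_derivative X (at x) h # ws)"
proof -
  define D where "D b = frechet_derivative (\<lambda>y. \<omega> y (b # ws)) (at x)" for b
  define X' where "X' = frechet_derivative X (at x)"
  have D: "((\<lambda>y. \<omega> y (b # ws)) has_derivative D b) (at x)" for b
    unfolding D_def using diff(1) by (simp add: frechet_derivative_works[symmetric])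
  have X': "(X has_derivative X') (at x)"
    unfolding X'_def using diff(2) by (simp add: frechet_derivative_works[symmetric])
  have expand: "\<omega> y (v # ws) = (\<Sum>b\<in>Basis. (v \<bullet> b) * \<omega> y (b # ws))" if "y \<in> S" for y v
  proof -
    have lin: "linear (\<lambda>v. \<omega> y (v # ws))" by (rule covector_linear_Cons[OF \<omega>[OF that]]) simp
    have "\<omega> y (v # ws) = \<omega> y ((\<Sum>b\<in>Basis. (v \<bullet> b) *\<^sub>R b) # ws)" by (simp add: euclidean_representation)
    also have "\<dots> = (\<Sum>b\<in>Basis. (v \<bullet> b) * \<omega> y (b # ws))"
      by (simp only: linear_sum[OF lin] linear_scale[OF lin] real_scaleR_def)
    finally show ?thesis .
  qed
  have "((\<lambda>y. \<Sum>b\<in>Basis. (X y \<bullet> b) * \<omega> y (b # ws)) has_derivative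
      (\<lambda>h. \<Sum>b\<in>Basis. (X x \<bullet> b) * D b h + (X' h \<bullet> b) * \<omega> x (b # ws))) (at x)"
    by (intro has_derivative_sum has_derivative_mult has_derivative_inner_left D X')
  then have "((\<lambda>y. \<omega> y (X y # ws)) has_derivative
      (\<lambda>h. \<Sum>b\<in>Basis. (X x \<bullet> b) * D b h + (X' h \<bullet> b) * \<omega> x (b # ws))) (at x)"
    by (rule has_derivative_transform_within_open[OF _ S]) (simp add: expand[symmetric])
  moreover have "((\<lambda>y. \<Sum>b\<in>Basis. (X x \<bullet> b) * \<omega> y (b # ws)) has_derivative
      (\<lambda>h. \<Sum>b\<in>Basis. (X x \<bullet> b) * D b h)) (at x)"
    by (intro has_derivative_sum has_derivative_mult_right D)
  then have "((\<lambda>y. \<omega> y (X x # ws)) has_derivative (\<lambda>h. \<Sum>b\<in>Basis. (X x \<bullet> b) * D b h)) (at x)"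
    by (rule has_derivative_transform_within_open[OF _ S]) (simp add: expand[symmetric])
  ultimately show ?thesis
    by (simp add: frechet_derivative_eqI sum.distrib expand[OF S(2), symmetric] flip: X'_def)
qed

text \<open>By the product rule, d of the contraction has terms that differentiate X, which are
  those of the Lie derivative, and terms that differentiate \<omega>. The latter cancel against the
  contraction of d\<omega>, where \<open>X x\<close> occupies slot 0 and shifts every other sign by
  one; its slot-0 term is the derivative of \<omega> along X.\<close>

lemma local_cartan:
  fixes \<omega> :: "'v::euclidean_space \<Rightarrow> 'v list \<Rightarrow> real"
  assumes S: "open S" "x \<in> S" and \<omega>: "\<And>y. y \<in> S \<Longrightarrow> covector k (\<omega> y)"
    and diff: "\<And>vs. (\<lambda>y. \<omega> y vs) differentiable at x" "X differentiable at x"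
  shows "local_lie X \<omega> x vs = local_d (\<lambda>y. contract (X y) (\<omega> y)) x vs + contract (X x) (local_d \<omega> x) vs"
proof (cases "length vs = k")
  case True
  define X' where "X' = frechet_derivative X (at x)"
  have 1: "(-1) ^ i * frechet_derivative (\<lambda>y. contract (X y) (\<omega> y) (omit i vs)) (at x) (vs ! i) =
      (-1) ^ i * frechet_derivative (\<lambda>y. \<omega> y (X x # omit i vs)) (at x) (vs ! i)
      + \<omega> x (vs[i := X' (vs ! i)])" if "i < k" for i
  proof -
    have "Suc (length (omit i vs)) = k" using that True by simp
    then have "frechet_derivative (\<lambda>y. contract (X y) (\<omega> y) (omit i vs)) (at x) (vs ! i) =
      frechet_derivative (\<lambda>y. \<omega> y (X x # omit i vs)) (at x) (vs ! i) + \<omega> x (X' (vs ! i) # omit i vs)"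
      unfolding contract_def X'_def using \<omega> by (intro frechet_derivative_contract[OF S _ diff]) simp
    moreover have "\<omega> x (X' (vs ! i) # omit i vs) = (-1) ^ i * \<omega> x (vs[i := X' (vs ! i)])"
      using covector_move_update[OF \<omega>[OF S(2)], of i vs] that True by (simp add: omit_def)
    ultimately show ?thesis
      by (simp add: distrib_left flip: mult.assoc power_add) 
  qed
  have "contract (X x) (local_d \<omega> x) vs = frechet_derivative (\<lambda>y. \<omega> y vs) (at x) (X x)
      + (\<Sum>i<k. - ((-1) ^ i * frechet_derivative (\<lambda>y. \<omega> y (X x # omit i vs)) (at x) (vs ! i)))"
    unfolding contract_def local_d_def using True
    by (simp add: sum.lessThan_Suc_shift omit_def del: sum.lessThan_Suc)
  moreover have "local_d (\<lambda>y. contract (X y) (\<omega> y)) x vs =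
      (\<Sum>i<k. (-1) ^ i * frechet_derivative (\<lambda>y. \<omega> y (X x # omit i vs)) (at x) (vs ! i))
      + (\<Sum>i<k. \<omega> x (vs[i := X' (vs ! i)]))"
    unfolding local_d_def using True by (simp add: 1 sum.distrib)
  ultimately show ?thesis
    using True by (simp add: local_lie_def X'_def sum_negf)
next
  case False
  \<comment> \<open>On lists of the wrong length every term is the value or the derivative of a
    function that vanishes on \<open>S\<close>, so the identity holds for all lists.\<close>
  have 0: "\<omega> y ws = 0" if "y \<in> S" "length ws \<noteq> k" for y ws
    using covector_length[OF \<omega>] that by blast
  have d0: "frechet_derivative (\<lambda>y. \<omega> y (Z y # ws)) (at x) = (\<lambda>_. 0)" if "Suc (length ws) \<noteq> k" for ws Z
    by (rule frechet_derivative_0_open[OF S]) (simp add: 0 that)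
  have "frechet_derivative (\<lambda>y. \<omega> y vs) (at x) = (\<lambda>_. 0)"
    by (rule frechet_derivative_0_open[OF S]) (simp add: 0 False)
  moreover have "local_d (\<lambda>y. contract (X y) (\<omega> y)) x vs = 0"
    unfolding local_d_def contract_def using False by (intro sum.neutral ballI) (simp add: d0)
  moreover have "local_d \<omega> x (X x # vs) = 0"
  proof -
    have "frechet_derivative (\<lambda>y. \<omega> y (omit i (X x # vs))) (at x) = (\<lambda>_. 0)" if "i < Suc (length vs)" for i
      by (rule frechet_derivative_0_open[OF S]) (use that False in \<open>simp add: 0\<close>)
    then show ?thesis unfolding local_d_def by (intro sum.neutral) simp
  qed
  ultimately show ?thesis
    using False by (simp add: local_lie_def contract_def 0[OF S(2)])
qed

section \<open>Manifolds\<close>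

lemma smooth_on_differentiable_on: "smooth_on f S \<Longrightarrow> f differentiable_on S"
  unfolding smooth_on_def by (metis Ck_on.simps(2))

context
  fixes M :: "'a topology" and A :: "('a, 'n::finite) chart set"
  assumes M: "smooth_manifold M A"
begin

lemma chart_homeomorphic:
  assumes "c \<in> A"
  shows "homeomorphic_map (subtopology M (chart_dom c)) (top_of_set (chart_img c)) (chart_map c)"
    "openin M (chart_dom c)" "open (chart_img c)"
  using M assms by (auto simp: smooth_manifold_def)

lemma chart_inj: "c \<in> A \<Longrightarrow> inj_on (chart_map c) (chart_dom c)"
  using homeomorphic_imp_injective_map[OF chart_homeomorphic(1)] chart_homeomorphic(2)[THEN openin_subset]
  by (simp add: topspace_subtopology Int_absorb1)

lemma chart_inv_chart_map: "c \<in> A \<Longrightarrow> p \<in> chart_dom c \<Longrightarrow> chart_inv c (chart_map c p) = p"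
  unfolding chart_inv_def by (rule inv_into_f_f[OF chart_inj])

lemma open_chart_overlap:
  assumes "c \<in> A" "d \<in> A"
  shows "open (chart_map c ` (chart_dom c \<inter> chart_dom d))"
proof -
  have "openin (subtopology M (chart_dom c)) (chart_dom c \<inter> chart_dom d)"
    using chart_homeomorphic(2)[OF assms(2)] by (metis inf_commute openin_subtopology)
  then have "openin (top_of_set (chart_img c)) (chart_map c ` (chart_dom c \<inter> chart_dom d))"
    using homeomorphic_imp_open_map[OF chart_homeomorphic(1)[OF assms(1)]] by (simp add: open_map_def)
  then show ?thesis using chart_homeomorphic(3)[OF assms(1)] openin_open_trans by blast
qed

section \<open>Jacobians and tangent vectors\<close>

lemma has_derivative_transition:
  assumes "c \<in> charts_at A p" "d \<in> charts_at A p"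
  shows "(transition c d has_derivative jac c d p) (at (chart_map c p))"
proof -
  have cd: "c \<in> A" "d \<in> A" "p \<in> chart_dom c \<inter> chart_dom d" using assms by (auto simp: charts_at_def)
  then have "transition c d differentiable_on chart_map c ` (chart_dom c \<inter> chart_dom d)"
    using M by (intro smooth_on_differentiable_on) (simp add: smooth_manifold_def)
  then have "transition c d differentiable at (chart_map c p)"
    using open_chart_overlap[OF cd(1,2)] cd(3) by (simp add: differentiable_on_eq_differentiable_at)
  then show ?thesis by (simp add: jac_def frechet_derivative_works[symmetric])
qed

lemma transition_chart_map:
  "c \<in> A \<Longrightarrow> p \<in> chart_dom c \<Longrightarrow> transition c d (chart_map c p) = chart_map d p"
  by (simp add: transition_def chart_inv_chart_map)

text \<open>The chain rule; the composed transition map agrees with the direct one on the overlap,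
  which is open in coordinates. This makes the Jacobian images of one coordinate vector a compatible
  family.\<close>

lemma jac_jac:
  assumes "c \<in> charts_at A p" "d \<in> charts_at A p" "e \<in> charts_at A p"
  shows "jac d e p (jac c d p w) = jac c e p w"
proof -
  have cd: "c \<in> A" "d \<in> A" "p \<in> chart_dom c \<inter> chart_dom d" using assms by (auto simp: charts_at_def)
  have "(transition d e \<circ> transition c d has_derivative jac d e p \<circ> jac c d p) (at (chart_map c p))"
    using assms cd
    by (intro diff_chain_at has_derivative_transition) (simp_all add: transition_chart_map has_derivative_transition)
  then have "(transition c e has_derivative jac d e p \<circ> jac c d p) (at (chart_map c p))"
    by (rule has_derivative_transform_within_open[OF _ open_chart_overlap[OF cd(1,2)]])
      (use cd in \<open>auto simp: transition_chart_map\<close>)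
  then have "jac d e p \<circ> jac c d p = jac c e p"
    by (rule has_derivative_unique[OF _ has_derivative_transition[OF assms(1,3)]])
  then show ?thesis by (simp add: fun_eq_iff)
qed

lemma jac_self:
  assumes "c \<in> charts_at A p"
  shows "jac c c p w = w"
proof -
  have c: "c \<in> A" "p \<in> chart_dom c" using assms by (auto simp: charts_at_def)
  have "((\<lambda>x. x) has_derivative (\<lambda>x. x)) (at (chart_map c p))" by (rule has_derivative_ident)
  then have "(transition c c has_derivative (\<lambda>x. x)) (at (chart_map c p))"
    by (rule has_derivative_transform_within_open[OF _ chart_homeomorphic(3)[OF c(1)]])
      (use c in \<open>auto simp: transition_chart_map\<close>)
  then have "jac c c p = (\<lambda>x. x)"
    using has_derivative_unique[OF has_derivative_transition[OF assms assms]] by blast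
  then show ?thesis by simp
qed

text \<open>A linear section of the coordinate map at p. Composed with a \<open>tangent_iso\<close>,
  it gives a linear map between coordinate spaces.\<close>

lemma tangent_vector_of_coordinates:
  assumes c: "c \<in> charts_at A p"
  obtains u where "\<And>w. u w \<in> tangent_space A p" "\<And>w. u w c = w"
    "\<And>a b w w'. u (a *\<^sub>R w + b *\<^sub>R w') = (\<lambda>d. a *\<^sub>R u w d + b *\<^sub>R u w' d)"
proof
  let ?u = "\<lambda>w d. if d \<in> charts_at A p then jac c d p w else 0"
  show "?u w \<in> tangent_space A p" for w
    by (simp add: tangent_space_def jac_jac c)
  show "?u w c = w" for w by (simp add: c jac_self)
  have "linear (jac c d p)" if "d \<in> charts_at A p" for d
    using has_derivative_transition[OF c that] has_derivative_linear by blast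
  then show "?u (a *\<^sub>R w + b *\<^sub>R w') = (\<lambda>d. a *\<^sub>R ?u w d + b *\<^sub>R ?u w' d)" for a b w w'
    by (auto simp: linear_add linear_scale)
qed

section \<open>From chart expressions to the manifold\<close>

lemma charts_at_chart_inv:
  assumes "c \<in> A" "x \<in> chart_img c"
  shows "c \<in> charts_at A (chart_inv c x)" "chart_map c (chart_inv c x) = x"
  using assms by (auto simp: charts_at_def chart_inv_chart_map)

lemma ext_d_eq_local_d:
  "c \<in> charts_at A p \<Longrightarrow> ext_d A \<omega> p c vs = local_d (\<lambda>x. \<omega> (chart_inv c x) c) (chart_map c p) vs"
  by (simp add: ext_d_def local_d_def omit_def)

lemma lie_deriv_eq_local_lie:
  "c \<in> charts_at A p \<Longrightarrow>
    lie_deriv A X \<omega> p c vs = local_lie (\<lambda>x. X (chart_inv c x) c) (\<lambda>x. \<omega> (chart_inv c x) c) (chart_map c p) vs"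
  by (auto simp: lie_deriv_def local_lie_def charts_at_def chart_inv_chart_map)

lemma ext_d_ext_d:
  assumes "\<omega> \<in> dforms A k"
  shows "ext_d A (ext_d A \<omega>) = zero_form"
proof (intro ext)
  fix p and c :: "('a, 'n) chart" and vs
  show "ext_d A (ext_d A \<omega>) p c vs = zero_form p c vs"
  proof (cases "c \<in> charts_at A p")
    case True
    then have c: "c \<in> A" "chart_map c p \<in> chart_img c" by (auto simp: charts_at_def)
    have "ext_d A (ext_d A \<omega>) p c vs = local_d (local_d (\<lambda>x. \<omega> (chart_inv c x) c)) (chart_map c p) vs"
      unfolding ext_d_eq_local_d[OF True]
      by (rule local_d_cong_open[OF chart_homeomorphic(3)[OF c(1)] c(2)])
        (simp add: ext_d_eq_local_d charts_at_chart_inv c(1))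
    also have "\<dots> = 0"
      using assms c by (intro local_d_local_d[OF chart_homeomorphic(3)]) (auto simp: dforms_def smooth_on_def)
    finally show ?thesis by (simp add: zero_form_def)
  qed (simp add: ext_d_def zero_form_def)
qed

text \<open>The assumptions on \<omega> are stated chart by chart, in the form in which they are
  established for \<open>star_phi\<close>.\<close>

lemma cartan_formula:
  assumes \<omega>: "\<And>p c. c \<in> charts_at A p \<Longrightarrow> covector k (\<omega> p c)"
    "\<And>c vs. c \<in> A \<Longrightarrow> (\<lambda>x. \<omega> (chart_inv c x) c vs) differentiable_on chart_img c"
    and X: "X \<in> vector_fields A"
  shows "lie_deriv A X \<omega> p c vs = ext_d A (Defs.interior X \<omega>) p c vs + Defs.interior X (ext_d A \<omega>) p c vs"
proof (cases "c \<in> charts_at A p")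
  case True
  then have c: "c \<in> A" "p \<in> chart_dom c" "chart_map c p \<in> chart_img c" by (auto simp: charts_at_def)
  note op = chart_homeomorphic(3)[OF c(1)]
  have "(\<lambda>x. X (chart_inv c x) c) differentiable_on chart_img c"
    using X c(1) by (intro smooth_on_differentiable_on) (simp add: vector_fields_def)
  then have "(\<lambda>x. X (chart_inv c x) c) differentiable at (chart_map c p)"
    using op c(3) by (simp only: differentiable_on_eq_differentiable_at)
  moreover have "(\<lambda>x. \<omega> (chart_inv c x) c vs) differentiable at (chart_map c p)" for vs
    using \<omega>(2)[OF c(1), of vs] op c(3) by (simp only: differentiable_on_eq_differentiable_at)
  ultimately show ?thesis
    using local_cartan[OF op c(3), of k "\<lambda>x. \<omega> (chart_inv c x) c" "\<lambda>x. X (chart_inv c x) c" vs]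
      \<omega>(1) charts_at_chart_inv(1)[OF c(1)] c(1,2)
    by (simp add: lie_deriv_eq_local_lie[OF True] ext_d_eq_local_d[OF True] Defs.interior_def
        chart_inv_chart_map contract_def)
next
  case False
  then show ?thesis by (simp add: lie_deriv_def ext_d_def Defs.interior_def contract_def)
qed

end

text \<open>The isomorphism is transported to coordinates by composing it with the section above.
  \<open>g2_structure\<close> fixes the values on triples; on lists of any other length both forms
  are 0.\<close>

lemma g2_structure_in_phi0_orbit:
  assumes M: "smooth_manifold M A" and \<phi>: "g2_structure A \<phi>" and c: "c \<in> charts_at A p"
  shows "in_phi0_orbit (\<phi> p c)"
proof -
  have cov: "covector 3 (\<phi> p c)" using \<phi> c by (auto simp: g2_structure_def dforms_def)
  have "p \<in> (\<Union>c\<in>A. chart_dom c)" using c by (auto simp: charts_at_def)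
  then obtain L where L: "tangent_iso A p L"
    and phi: "\<And>u v w. u \<in> tangent_space A p \<Longrightarrow> v \<in> tangent_space A p \<Longrightarrow> w \<in> tangent_space A p \<Longrightarrow>
      \<phi> p c [u c, v c, w c] = phi0 [L u, L v, L w]"
    using \<phi> c unfolding g2_structure_def by blast
  obtain u where u: "\<And>w. u w \<in> tangent_space A p" "\<And>w. u w c = w"
    "\<And>a b w w'. u (a *\<^sub>R w + b *\<^sub>R w') = (\<lambda>d. a *\<^sub>R u w d + b *\<^sub>R u w' d)"
    by (rule tangent_vector_of_coordinates[OF M c]) (rule that)
  define L' where "L' w = L (u w)" for w
  have comb: "L' (a *\<^sub>R w + b *\<^sub>R w') = a *\<^sub>R L' w + b *\<^sub>R L' w'" for a b w w'
    using L u(1) by (simp add: L'_def u(3) tangent_iso_def)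
  have "linear L'"
    using comb[of 1 _ 1] comb[of _ _ 0] by (intro linearI) simp_all
  moreover have "inj L'"
    using L u(1,2) unfolding L'_def tangent_iso_def bij_betw_def inj_on_def by metis
  moreover have "\<phi> p c = (\<lambda>vs. phi0 (map L' vs))"
  proof
    fix vs
    show "\<phi> p c vs = phi0 (map L' vs)"
    proof (cases "length vs = 3")
      case True
      then obtain x y z where "vs = [x, y, z]" by (auto simp: numeral_3_eq_3 length_Suc_conv)
      then show ?thesis using phi[of "u x" "u y" "u z"] u(1,2) by (simp add: L'_def)
    qed (simp add: covector_length[OF cov] phi0_length)
  qed
  ultimately show ?thesis unfolding in_phi0_orbit_def by blast
qed

theorem theorem2p2:
  fixes M :: "'a topology"
    and A :: "('a, 7) chart set"
    and \<phi> :: "('a, 7) dform"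
  assumes "smooth_manifold M A"
    and "g2_structure A \<phi>"
    and "coclosed A \<phi>"
  shows "coRoc_fields A \<phi> \<subseteq> coG2_fields A \<phi> \<and>
    ((\<forall>\<alpha>\<in>Omega37 A \<phi>. ext_d A \<alpha> = zero_form \<longrightarrow> (\<exists>\<beta>\<in>dforms A 2. \<alpha> = ext_d A \<beta>)) \<longrightarrow>
      coRoc_fields A \<phi> = coG2_fields A \<phi>)"
proof -
  note M = assms(1)
  have cov: "covector 4 (star_phi \<phi> p c)" if "c \<in> charts_at A p" for p c
    unfolding star_phi_def
    by (rule covector_g2_star3[OF g2_structure_in_phi0_orbit[OF M assms(2) that]])
  have diff: "(\<lambda>x. star_phi \<phi> (chart_inv c x) c vs) differentiable_on chart_img c" if c: "c \<in> A" for c vs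
    unfolding star_phi_def
  proof (rule differentiable_on_g2_star3)
    show "in_phi0_orbit (\<phi> (chart_inv c x) c)" if "x \<in> chart_img c" for x
      by (rule g2_structure_in_phi0_orbit[OF M assms(2) charts_at_chart_inv(1)[OF M c that]])
    show "(\<lambda>x. \<phi> (chart_inv c x) c vs) differentiable_on chart_img c" for vs
      using assms(2) c by (intro smooth_on_differentiable_on) (simp add: g2_structure_def dforms_def)
  qed
  have lie: "lie_deriv A X (star_phi \<phi>) = ext_d A (Defs.interior X (star_phi \<phi>))"
    if "X \<in> vector_fields A" for X
    using cartan_formula[OF M cov diff that] assms(3)
    by (simp add: fun_eq_iff coclosed_def zero_form_def Defs.interior_def contract_def)
  have sub: "coRoc_fields A \<phi> \<subseteq> coG2_fields A \<phi>"
    using lie ext_d_ext_d[OF M] by (auto simp: coRoc_fields_def coRoc_forms_def coG2_fields_def)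
  moreover have "coG2_fields A \<phi> \<subseteq> coRoc_fields A \<phi>"
    if exact: "\<forall>\<alpha>\<in>Omega37 A \<phi>. ext_d A \<alpha> = zero_form \<longrightarrow> (\<exists>\<beta>\<in>dforms A 2. \<alpha> = ext_d A \<beta>)"
  proof
    fix X assume "X \<in> coG2_fields A \<phi>"
    then have X: "X \<in> vector_fields A" "ext_d A (Defs.interior X (star_phi \<phi>)) = zero_form"
      using lie by (auto simp: coG2_fields_def)
    then have "Defs.interior X (star_phi \<phi>) \<in> Omega37 A \<phi>" by (auto simp: Omega37_def)
    \<comment> \<open>\<beta> is itself a coRochesterian form with field X, because its differential
      lies in \<open>Omega37\<close>.\<close>
    with exact X(2) obtain \<beta> where "\<beta> \<in> dforms A 2" "Defs.interior X (star_phi \<phi>) = ext_d A \<beta>" by blast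
    with \<open>_ \<in> Omega37 A \<phi>\<close> X(1) show "X \<in> coRoc_fields A \<phi>"
      by (auto simp: coRoc_fields_def coRoc_forms_def)
  qed
  ultimately show ?thesis by blast
qed

end
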